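(* Let $f:\mathfrak X\to\mathbb C$ and $1<p<2$, with $p'=p/(p-1)$. (1) Suppose $z=n\tau+i\delta_{p'}$ for some $n\in\mathbb Z$. If there exists $M>0$ such that $\|\mathcal L^k f\|_{L^{p',\infty}(\mathfrak X)}\le M|\gamma(z)|^k$ for all $k\in\mathbb Z_+$, then $\mathcal Lf=\gamma(z)f$. (2) Suppose $z=(2n+1)\tau/2+i\delta_{p'}$ for some $n\in\mathbb Z$. Suppose there is a sequence $\{f_{-k}\}_{k\in\mathbb Z_+}$ of functions on $\mathfrak X$ with $f_0=f$ and $\mathcal L f_{-k-1}=f_{-k}$ for all $k\in\mathbb Z_+$ (i.e. $f_{-k}=\mathcal L^{-k}f$), and $M>0$ such that $\|f_{-k}\|_{L^{p',\infty}(\mathfrak X)}\le M|\gamma(z)|^{-k}$ for all $k\in\mathbb Z_+$. Then $\mathcal Lf=\gamma(z)f$. In either case there exists $F\in L^{p'}(\Omega)$ such that $f=\mathcal P_zF$.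
   Context: $\mathfrak X$ is a homogeneous tree of degree $q+1$ with $q\ge 2$ (a connected graph without loops in which every vertex has exactly $q+1$ neighbours), identified with its vertex set, with $d(x,y)$ the graph distance; fix a base vertex $o$ and write $|x|=d(o,x)$. The Laplacian is $\mathcal L f(x)=f(x)-\frac{1}{q+1}\sum_{y:d(x,y)=1}f(y)$. Put $\tau=2\pi/\log q$, $\gamma(z)=1-\frac{q^{1/2+iz}+q^{1/2-iz}}{q+1}$, and for $p\in(1,\infty)$, $\delta_p=\frac1p-\frac12$. $\mathbb Z_+$ denotes the nonnegative integers. $L^{p,\infty}(\mathfrak X)$ is the weak $L^p$ (Lorentz) space for counting measure on $\mathfrak X$. The boundary $\Omega$ is the set of infinite geodesic rays $\omega=(\omega_0=o,\omega_1,\dots)$ from $o$, with the canonical probability measure $\nu$ (rays through a given vertex $v$ with $|v|=n\ge1$ form a set of measure $\frac{1}{(q+1)q^{n-1}}$). The height is $h_\omega(x)=\lim_{n\to\infty}(n-d(x,\omega_n))$, the Poisson kernel $p(x,\omega)=q^{h_\omega(x)}$, and the Poisson transform $\mathcal P_zF(x)=\int_\Omega p(x,\omega)^{1/2+iz}F(\omega)\,d\nu(\omega)$. *)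

theory Defs
  imports "HOL-Probability.Probability"
begin

definition walk :: "('v \<Rightarrow> 'v \<Rightarrow> bool) \<Rightarrow> nat \<Rightarrow> (nat \<Rightarrow> 'v) \<Rightarrow> bool" where
  "walk E n w \<longleftrightarrow> (\<forall>i<n. E (w i) (w (Suc i)))"

definition homogeneous_tree :: "('v \<Rightarrow> 'v \<Rightarrow> bool) \<Rightarrow> nat \<Rightarrow> bool" where
  "homogeneous_tree E q \<longleftrightarrow>
     (\<forall>x y. E x y \<longrightarrow> E y x) \<and>
     (\<forall>x. \<not> E x x) \<and>
     (\<forall>x y. \<exists>n w. walk E n w \<and> w 0 = x \<and> w n = y) \<and>
     (\<forall>n w. n \<ge> 1 \<and> walk E n w \<and> w n = w 0 \<and> (\<forall>i. i + 1 < n \<longrightarrow> w (i + 2) \<noteq> w i) \<longrightarrow> False) \<and>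
     (\<forall>x. finite {y. E x y} \<and> card {y. E x y} = q + 1)"

definition gdist :: "('v \<Rightarrow> 'v \<Rightarrow> bool) \<Rightarrow> 'v \<Rightarrow> 'v \<Rightarrow> nat" where
  "gdist E x y = (LEAST n. \<exists>w. walk E n w \<and> w 0 = x \<and> w n = y)"

definition lap :: "('v \<Rightarrow> 'v \<Rightarrow> bool) \<Rightarrow> nat \<Rightarrow> ('v \<Rightarrow> complex) \<Rightarrow> ('v \<Rightarrow> complex)" where
  "lap E q f x = f x - (1 / of_nat (q + 1)) * (\<Sum>y\<in>{y. E x y}. f y)"

definition tau :: "nat \<Rightarrow> real" where
  "tau q = 2 * pi / ln (real q)"

definition gam :: "nat \<Rightarrow> complex \<Rightarrow> complex" where
  "gam q z = 1 - (of_real (real q) powr (1/2 + \<i> * z) + of_real (real q) powr (1/2 - \<i> * z)) / of_nat (q + 1)"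

definition delta :: "real \<Rightarrow> real" where
  "delta p = 1 / p - 1 / 2"

definition weak_Lp_norm :: "real \<Rightarrow> ('v \<Rightarrow> complex) \<Rightarrow> ereal" where
  "weak_Lp_norm p g =
     (SUP t\<in>{0<..}. (if finite {x. cmod (g x) > t}
                      then ereal (t * real (card {x. cmod (g x) > t}) powr (1 / p))
                      else \<infinity>))"

definition boundary :: "('v \<Rightarrow> 'v \<Rightarrow> bool) \<Rightarrow> 'v \<Rightarrow> (nat \<Rightarrow> 'v) set" where
  "boundary E b = {\<omega>. \<omega> 0 = b \<and> (\<forall>m n. gdist E (\<omega> m) (\<omega> n) = nat \<bar>int m - int n\<bar>)}"

definition cylinder :: "('v \<Rightarrow> 'v \<Rightarrow> bool) \<Rightarrow> 'v \<Rightarrow> 'v \<Rightarrow> (nat \<Rightarrow> 'v) set" where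
  "cylinder E b v = {\<omega>\<in>boundary E b. \<omega> (gdist E b v) = v}"

text \<open>The canonical probability measure nu on the boundary (characterised on the
  sigma-algebra generated by the cylinders, where it is unique).\<close>
definition canonical_boundary_measure ::
  "('v \<Rightarrow> 'v \<Rightarrow> bool) \<Rightarrow> nat \<Rightarrow> 'v \<Rightarrow> (nat \<Rightarrow> 'v) measure \<Rightarrow> bool" where
  "canonical_boundary_measure E q b \<nu> \<longleftrightarrow>
     prob_space \<nu> \<and>
     space \<nu> = boundary E b \<and>
     sets \<nu> = sigma_sets (boundary E b) (range (cylinder E b)) \<and>
     (\<forall>v. gdist E b v \<ge> 1 \<longrightarrow>
        emeasure \<nu> (cylinder E b v) = ennreal (1 / (real (q + 1) * real q ^ (gdist E b v - 1))))"

definition height :: "('v \<Rightarrow> 'v \<Rightarrow> bool) \<Rightarrow> (nat \<Rightarrow> 'v) \<Rightarrow> 'v \<Rightarrow> real" where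
  "height E \<omega> x = lim (\<lambda>n. real n - real (gdist E x (\<omega> n)))"

definition poisson_kernel :: "('v \<Rightarrow> 'v \<Rightarrow> bool) \<Rightarrow> nat \<Rightarrow> 'v \<Rightarrow> (nat \<Rightarrow> 'v) \<Rightarrow> real" where
  "poisson_kernel E q x \<omega> = real q powr height E \<omega> x"

definition poisson_transform ::
  "('v \<Rightarrow> 'v \<Rightarrow> bool) \<Rightarrow> nat \<Rightarrow> (nat \<Rightarrow> 'v) measure \<Rightarrow> complex \<Rightarrow> ((nat \<Rightarrow> 'v) \<Rightarrow> complex) \<Rightarrow> 'v \<Rightarrow> complex" where
  "poisson_transform E q \<nu> z F x =
     (\<integral>\<omega>. of_real (poisson_kernel E q x \<omega>) powr (1/2 + \<i> * z) * F \<omega> \<partial>\<nu>)"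

definition in_Lp :: "(nat \<Rightarrow> 'v) measure \<Rightarrow> real \<Rightarrow> ((nat \<Rightarrow> 'v) \<Rightarrow> complex) \<Rightarrow> bool" where
  "in_Lp \<nu> p F \<longleftrightarrow> F \<in> borel_measurable \<nu> \<and> integrable \<nu> (\<lambda>\<omega>. norm (F \<omega>) powr p)"

end

theory Submission
  imports Defs
begin

text \<open>
  Write \<open>\<L> = I - A\<close> with \<open>A\<close> the averaging operator, and put
  \<open>\<alpha> = q\<^bsup>1/p'\<^esup>\<close>, \<open>\<beta> = q\<^bsup>1/p\<^esup>\<close>, \<open>\<rho> = (\<alpha> + \<beta>) / (q + 1)\<close>, so that \<open>\<gamma>(z) = 1 \<mp> \<rho>\<close>
  in the two cases. A weak \<open>L\<^bsup>p'\<^esup>\<close> bound controls the sum over a sphere of radius \<open>n\<close> by a multiple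
  of \<open>\<beta>\<^sup>n\<close>, and for the norm defined by these sphere sums \<open>A/\<rho>\<close> is a contraction.

  With \<open>P = \<plusminus>A/\<rho>\<close> the normalised orbit \<open>g\<^sub>m\<close> of \<open>f\<close> yields a bounded array \<open>D i m = (P\<^sup>i g\<^sub>m)(x)\<close>
  (or \<open>(P\<^sup>i g\<^bsub>m+i\<^esub>)(x)\<close>) with \<open>D i m = (1 - a) D i (m+1) + a D (i+1) m\<close>. Iterating the
  variance identity shows that such an array has \<open>D 0 1 = D 1 0\<close>, which is the eigenvalue equation.

  For the Poisson transform let \<open>B = q\<^bsup>1/2+iz\<^esup>\<close>. The eigenvalue equation makes
  \<open>f(x) - f(par x)/B\<close>, suitably scaled, a martingale on the boundary. The weak type bound
  makes it bounded in \<open>L\<^sup>2\<close>, so it converges in \<open>L\<^sup>1\<close> to some \<open>F\<close>. Counting the points where the scaled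
  martingale exceeds a fixed level over all spheres beyond radius \<open>N\<close>, and letting \<open>N \<rightarrow> \<infinity>\<close>, bounds the
  layer-cake sum of \<open>\<bar>F\<bar>\<^bsup>p'\<^esup>\<close>.
\<close>

subsection \<open>Bounded space-time harmonic functions and weak type bounds\<close>

text \<open>Only the highest level exceeded matters: for \<open>y\<close> above \<open>c ^ j\<close>
  and at most \<open>c ^ (j + 1)\<close> the single term \<open>c ^ (j + 1)\<close> dominates, and
  the leading 1 covers \<open>y \<le> 1\<close>. This is the layer-cake formula in a finite form
  with geometric levels.\<close>

lemma layer_bound:
  fixes c y :: real
  assumes "c > 1" "y \<le> c ^ J"
  shows "y \<le> 1 + (\<Sum>j<J. c ^ (j + 1) * of_bool (y > c ^ j))"
  using assms(2)
proof (induction J)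
  case (Suc J)
  have nn: "0 \<le> (\<Sum>j<J. c ^ (j + 1) * of_bool (y > c ^ j))"
    using assms(1) by (intro sum_nonneg) auto
  show ?case
  proof (cases "y \<le> c ^ J")
    case True
    then show ?thesis using Suc.IH by simp
  next
    case False
    then show ?thesis using Suc.prems nn by simp
  qed
qed auto

lemma geometric_partial_le:
  fixes x :: real
  assumes "0 \<le> x" "x < 1"
  shows "(\<Sum>j<J. x ^ j) \<le> 1 / (1 - x)"
  using sum_le_suminf[of "\<lambda>j. x ^ j" "{..<J}"] assms by (simp add: suminf_geometric summable_geometric)

text \<open>Dyadic layer-cake: the layer at height \<open>2 ^ j * t\<close> has squared weight of
  order \<open>4 ^ j\<close> and, by the weak bound, a count of order
  \<open>2 powr (- r * j)\<close>. The layers form a geometric series of ratio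
  \<open>2 powr (2 - r)\<close>, convergent because \<open>r > 2\<close>. Apart from the displayed
  power of \<open>card S\<close>, the constant does not depend on \<open>S\<close>, so it serves all
  spheres at once.\<close>

lemma weak_type_sum_squares:
  fixes h :: "'a \<Rightarrow> real" and K r :: real
  assumes S: "finite S" and h: "\<And>x. x \<in> S \<Longrightarrow> h x \<ge> 0" and K: "K \<ge> 0" and r: "r > 2"
    and weak: "\<And>t. t > 0 \<Longrightarrow> real (card {x\<in>S. h x > t}) \<le> K * t powr (- r)"
  shows "(\<Sum>x\<in>S. (h x)\<^sup>2) \<le> (1 + 4 * K / (1 - 2 powr (2 - r))) * real (card S) powr (1 - 2 / r)"
proof (cases "S = {}")
  case False
  define s where "s = real (card S)"
  have s: "s > 0" using False S by (simp add: s_def card_gt_0_iff)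
  \<comment> \<open>At this level \<open>t powr (- r)\<close> equals \<open>card S\<close>, so the
    weak bound becomes comparable with the trivial count. Points below it are covered by the term 1
    of \<open>layer_bound\<close>.\<close>
  define t where "t = s powr (- 1 / r)"
  have t: "t > 0" using s by (simp add: t_def)
  define x where "x = (2::real) powr (2 - r)"
  have x: "0 \<le> x" "x < 1" using r by (auto simp: x_def powr_less_one)
  obtain J where J: "\<And>y. y \<in> S \<Longrightarrow> (h y / t)\<^sup>2 \<le> 4 ^ J"
  proof -
    obtain J where "(\<Sum>y\<in>S. (h y / t)\<^sup>2) \<le> 4 ^ J"
      using real_arch_pow[of 4 "\<Sum>y\<in>S. (h y / t)\<^sup>2"] by (auto intro: less_imp_le)
    moreover have "(h y / t)\<^sup>2 \<le> (\<Sum>y\<in>S. (h y / t)\<^sup>2)" if "y \<in> S" for y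
      using S that by (intro member_le_sum) auto
    ultimately show ?thesis using that by (meson order_trans)
  qed
  have lvl: "(h y / t)\<^sup>2 > 4 ^ j \<longleftrightarrow> h y > 2 ^ j * t" if "y \<in> S" for y j
  proof -
    have "(4::real) ^ j = (2 ^ j)\<^sup>2" by (simp add: power2_eq_square power_mult_distrib[symmetric])
    then have "(h y / t)\<^sup>2 > 4 ^ j \<longleftrightarrow> h y / t > 2 ^ j"
      using h[OF that] t by (simp add: abs_le_square_iff[symmetric] not_le[symmetric])
    then show ?thesis using t by (simp add: field_simps)
  qed
  have card: "4 ^ (j + 1) * real (card {y\<in>S. h y > 2 ^ j * t}) \<le> 4 * K * s * x ^ j" for j :: nat
  proof -
    have "real (card {y\<in>S. h y > 2 ^ j * t}) \<le> K * (2 ^ j * t) powr (- r)"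
      using t by (intro weak) simp
    also have "(2 ^ j * t) powr (- r) = 2 powr (- r * j) * s"
      using s t r by (simp add: powr_mult t_def powr_powr powr_realpow[symmetric] mult.commute)
    finally have "4 ^ (j + 1) * real (card {y\<in>S. h y > 2 ^ j * t}) \<le> 4 ^ (j + 1) * (K * (2 powr (- r * j) * s))"
      by (intro mult_left_mono) auto
    also have "\<dots> = 4 * K * s * (2 powr (2 * j) * 2 powr (- r * j))"
    proof -
      have "(4::real) ^ j = 2 powr (2 * j)"
        by (metis of_nat_mult of_nat_numeral power_mult powr_realpow zero_less_numeral power2_eq_square num_double numeral_times_numeral)
      then show ?thesis by simp
    qed
    also have "2 powr (2 * j) * 2 powr (- r * j) = x ^ j"
      by (simp add: x_def powr_add[symmetric] powr_realpow[symmetric] powr_powr algebra_simps)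
    finally show ?thesis .
  qed
  have "(\<Sum>y\<in>S. (h y / t)\<^sup>2) \<le> (\<Sum>y\<in>S. 1 + (\<Sum>j<J. 4 ^ (j + 1) * of_bool ((h y / t)\<^sup>2 > 4 ^ j)))"
    by (intro sum_mono layer_bound J) auto
  also have "\<dots> = s + (\<Sum>j<J. 4 ^ (j + 1) * real (card {y\<in>S. h y > 2 ^ j * t}))"
  proof -
    have "(\<Sum>y\<in>S. 4 ^ (j + 1) * of_bool ((h y / t)\<^sup>2 > 4 ^ j)) = 4 ^ (j + 1) * real (card {y\<in>S. h y > 2 ^ j * t})" for j :: nat
    proof -
      have "(\<Sum>y\<in>S. of_bool ((h y / t)\<^sup>2 > 4 ^ j)) = (\<Sum>y\<in>S. (of_bool (h y > 2 ^ j * t) :: real))"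
        by (intro sum.cong refl) (simp add: lvl)
      also have "\<dots> = real (card {y\<in>S. h y > 2 ^ j * t})"
        using S by (simp add: Int_def)
      finally show ?thesis by (simp only: sum_distrib_left[symmetric])
    qed
    then show ?thesis
      by (simp only: sum.distrib) (subst sum.swap, simp add: s_def)
  qed
  also have "\<dots> \<le> s + (\<Sum>j<J. 4 * K * s * x ^ j)"
    by (intro add_left_mono sum_mono card)
  also have "\<dots> = s * (1 + 4 * K * (\<Sum>j<J. x ^ j))"
    by (simp only: sum_distrib_left[symmetric]) (simp add: algebra_simps)
  also have "\<dots> \<le> s * (1 + 4 * K * (1 / (1 - x)))"
    using s K geometric_partial_le[OF x] by (intro mult_left_mono add_left_mono) auto
  finally have "(\<Sum>y\<in>S. (h y / t)\<^sup>2) \<le> s * (1 + 4 * K / (1 - x))" by simp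
  then have "(\<Sum>y\<in>S. (h y)\<^sup>2) \<le> t\<^sup>2 * (s * (1 + 4 * K / (1 - x)))"
  proof -
    have "(\<Sum>y\<in>S. (h y / t)\<^sup>2) = (\<Sum>y\<in>S. (h y)\<^sup>2) / t\<^sup>2"
      by (simp add: power_divide sum_divide_distrib)
    then show ?thesis
      using t \<open>(\<Sum>y\<in>S. (h y / t)\<^sup>2) \<le> s * (1 + 4 * K / (1 - x))\<close> by (simp add: pos_divide_le_eq mult.commute)
  qed
  also have "t\<^sup>2 * (s * (1 + 4 * K / (1 - x))) = (1 + 4 * K / (1 - x)) * (t\<^sup>2 * s)" by simp
  also have "t\<^sup>2 * s = s powr (1 - 2 / r)"
  proof -
    have "t\<^sup>2 * s = s powr (- 1 / r) * s powr (- 1 / r) * s powr 1"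
      using s by (simp add: t_def power2_eq_square)
    also have "\<dots> = s powr (- 1 / r + - 1 / r + 1)" by (simp only: powr_add)
    finally show ?thesis by simp
  qed
  finally show ?thesis by (simp add: s_def x_def)
qed auto

lemma weak_type_sum:
  fixes h :: "'a \<Rightarrow> real" and K r :: real
  assumes S: "finite S" and h: "\<And>x. x \<in> S \<Longrightarrow> h x \<ge> 0" and K: "K \<ge> 0" and r: "r > 2"
    and weak: "\<And>t. t > 0 \<Longrightarrow> real (card {x\<in>S. h x > t}) \<le> K * t powr (- r)"
  shows "(\<Sum>x\<in>S. h x) \<le> sqrt (1 + 4 * K / (1 - 2 powr (2 - r))) * real (card S) powr (1 - 1 / r)"
proof -
  let ?C = "1 + 4 * K / (1 - 2 powr (2 - r))" and ?s = "real (card S)"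
  have C: "?C \<ge> 0"
  proof -
    have "(2::real) powr (2 - r) < 1" using r by (simp add: powr_less_one)
    then show ?thesis using K by simp
  qed
  have "(\<Sum>x\<in>S. h x)\<^sup>2 \<le> ?s * (\<Sum>x\<in>S. (h x)\<^sup>2)"
    using Cauchy_Schwarz_ineq_sum[of "\<lambda>_. 1" h S] by simp
  also have "\<dots> \<le> ?s * (?C * ?s powr (1 - 2 / r))"
    using weak_type_sum_squares[OF assms] by (intro mult_left_mono) auto
  also have "\<dots> = ?C * (?s powr (1 - 1 / r))\<^sup>2"
  proof (cases "?s = 0")
    case False
    then have "?s * ?s powr (1 - 2 / r) = ?s powr (1 + (1 - 2 / r))" unfolding powr_add by simp
    also have "\<dots> = (?s powr (1 - 1 / r))\<^sup>2"
      by (simp add: power2_eq_square powr_add[symmetric] algebra_simps add_divide_distrib[symmetric])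
    finally show ?thesis by simp
  qed simp
  also have "\<dots> = (sqrt ?C * ?s powr (1 - 1 / r))\<^sup>2"
    using C by (simp add: power_mult_distrib)
  finally show ?thesis by (rule power2_le_imp_le) (use C in simp)
qed

section \<open>Two-point variance and bounded space-time harmonic arrays\<close>

lemma variance_identity:
  fixes u v :: complex and a :: real
  shows "(cmod ((1 - a) * u + a * v))\<^sup>2 + a * (1 - a) * (cmod (u - v))\<^sup>2 =
    (1 - a) * (cmod u)\<^sup>2 + a * (cmod v)\<^sup>2"
  unfolding cmod_power2 by (simp add: power2_eq_square) algebra

text \<open>Read \<open>D\<close> as a harmonic function of a walk that raises \<open>m\<close> with
  probability \<open>1 - a\<close> and \<open>i\<close> with probability \<open>a\<close>. In one
  step the mean of its squared modulus grows by the variance, which is \<open>a * (1 - a)\<close>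
  times the squared modulus of the difference \<open>h\<close> of the two successors. Since
  \<open>h\<close> is harmonic as well, its squared modulus does not decrease in mean, so
  \<open>n\<close> steps add at least \<open>n\<close> times the initial variance. The total stays
  below \<open>M\<^sup>2\<close>, hence \<open>h = 0\<close>.\<close>

lemma bounded_space_time_harmonic:
  fixes D :: "nat \<Rightarrow> nat \<Rightarrow> complex" and a M :: real
  assumes a: "0 < a" "a < 1" and bd: "\<And>i m. cmod (D i m) \<le> M"
    and harm: "\<And>i m. D i m = (1 - a) * D i (Suc m) + a * D (Suc i) m"
  shows "D i (Suc m) = D (Suc i) m"
proof -
  define h where "h i m = D i (Suc m) - D (Suc i) m" for i m
  have h_harm: "h i m = (1 - a) * h i (Suc m) + a * h (Suc i) m" for i m
  proof -
    have "x - x' = (1 - a) * (y - z) + a * (z - w)"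
      if "x = (1 - a) * y + a * z" "x' = (1 - a) * z + a * w" for x x' y z w :: complex
      unfolding that by (simp add: algebra_simps)
    from this[OF harm[of i "Suc m"] harm[of "Suc i" m]] show ?thesis by (simp add: h_def)
  qed
  have key: "(cmod (D i m))\<^sup>2 + real n * (a * (1 - a) * (cmod (h i m))\<^sup>2) \<le> M\<^sup>2" for n i m
  proof (induction n arbitrary: i m)
    case 0
    show ?case using bd[of i m] by (simp add: power_mono)
  next
    case (Suc n)
    let ?c = "real n * (a * (1 - a))"
    have 1: "(cmod (D i m))\<^sup>2 + a * (1 - a) * (cmod (h i m))\<^sup>2 =
      (1 - a) * (cmod (D i (Suc m)))\<^sup>2 + a * (cmod (D (Suc i) m))\<^sup>2"
      using variance_identity[of a "D i (Suc m)" "D (Suc i) m"] harm[of i m] by (simp add: h_def)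
    have nn: "0 \<le> a * (1 - a) * (cmod (h i (Suc m) - h (Suc i) m))\<^sup>2" using a by simp
    have "(cmod (h i m))\<^sup>2 \<le> (1 - a) * (cmod (h i (Suc m)))\<^sup>2 + a * (cmod (h (Suc i) m))\<^sup>2"
      using variance_identity[of a "h i (Suc m)" "h (Suc i) m"] h_harm[of i m] nn
      by simp
    then have 2: "?c * (cmod (h i m))\<^sup>2 \<le> ?c * ((1 - a) * (cmod (h i (Suc m)))\<^sup>2 + a * (cmod (h (Suc i) m))\<^sup>2)"
      using a by (intro mult_left_mono) auto
    have "(cmod (D i m))\<^sup>2 + real (Suc n) * (a * (1 - a) * (cmod (h i m))\<^sup>2) =
       ((cmod (D i m))\<^sup>2 + a * (1 - a) * (cmod (h i m))\<^sup>2) + ?c * (cmod (h i m))\<^sup>2"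
      by (simp add: algebra_simps)
    also have "\<dots> \<le> (1 - a) * ((cmod (D i (Suc m)))\<^sup>2 + ?c * (cmod (h i (Suc m)))\<^sup>2)
        + a * ((cmod (D (Suc i) m))\<^sup>2 + ?c * (cmod (h (Suc i) m))\<^sup>2)"
    proof -
      have "(1 - a) * (u + ?c * x) + a * (v + ?c * y) = ((1 - a) * u + a * v) + ?c * ((1 - a) * x + a * y)"
        for u v x y :: real by (simp add: algebra_simps)
      then show ?thesis using 1 2 by simp
    qed
    also have "\<dots> \<le> (1 - a) * M\<^sup>2 + a * M\<^sup>2"
    proof -
      have "(cmod (D i' m'))\<^sup>2 + ?c * (cmod (h i' m'))\<^sup>2 \<le> M\<^sup>2" for i' m'
        using Suc.IH[of i' m'] by (simp only: mult.assoc)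
      then show ?thesis using a by (intro add_mono mult_left_mono) simp_all
    qed
    finally show ?case by (simp add: algebra_simps)
  qed
  have "h i m = 0"
  proof (rule ccontr)
    assume "h i m \<noteq> 0"
    then have pos: "a * (1 - a) * (cmod (h i m))\<^sup>2 > 0" using a by simp
    then obtain n where "M\<^sup>2 < real n * (a * (1 - a) * (cmod (h i m))\<^sup>2)"
      using reals_Archimedean3 by blast
    then show False using key[of i m n] zero_le_power2[of "cmod (D i m)"] by linarith
  qed
  then show ?thesis by (simp add: h_def)
qed

section \<open>Weak type bounds as bounds on the size of level sets\<close>

definition weak_type :: "real \<Rightarrow> real \<Rightarrow> ('a \<Rightarrow> complex) \<Rightarrow> bool" where
  "weak_type r K g \<longleftrightarrow> (\<forall>t>0. finite {x. cmod (g x) > t} \<and>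
     real (card {x. cmod (g x) > t}) \<le> K * t powr (- r))"

lemma weak_type_if_weak_Lp_norm_le:
  assumes "weak_Lp_norm r g \<le> ereal M" "M > 0" "r > 0"
  shows "weak_type r (M powr r) g"
  unfolding weak_type_def
proof (intro allI impI)
  fix t :: real assume t: "t > 0"
  let ?S = "{x. cmod (g x) > t}"
  have le: "(if finite ?S then ereal (t * real (card ?S) powr (1 / r)) else \<infinity>) \<le> ereal M"
    using t by (intro order_trans[OF SUP_upper assms(1)[unfolded weak_Lp_norm_def]]) auto
  \<comment> \<open>The infinite branch of the supremum cannot lie below \<open>ereal M\<close>.
    Finiteness has to be recorded because \<open>card\<close> is 0 on infinite sets.\<close>
  then have fin: "finite ?S" by (auto split: if_splits)
  with le have "real (card ?S) powr (1 / r) \<le> M / t"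
    using t by (simp add: field_simps)
  then have "(real (card ?S) powr (1 / r)) powr r \<le> (M / t) powr r"
    using assms by (intro powr_mono2) auto
  also have "(real (card ?S) powr (1 / r)) powr r = real (card ?S)"
    using assms by (simp add: powr_powr)
  also have "(M / t) powr r = M powr r * t powr (- r)"
    using assms t by (simp add: powr_divide powr_minus_divide)
  finally show "finite ?S \<and> real (card ?S) \<le> M powr r * t powr (- r)" using fin by blast
qed

lemma weak_type_divide:
  assumes "weak_type r K g" "c \<noteq> 0"
  shows "weak_type r (K * cmod c powr (- r)) (\<lambda>x. g x / c)"
  unfolding weak_type_def
proof (intro allI impI)
  fix t :: real assume t: "t > 0"
  have "{x. t < cmod (g x / c)} = {x. t * cmod c < cmod (g x)}"
    using assms(2) by (simp add: norm_divide field_simps)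
  moreover have "K * (t * cmod c) powr (- r) = K * cmod c powr (- r) * t powr (- r)"
    using t by (simp add: powr_mult)
  ultimately show "finite {x. t < cmod (g x / c)} \<and>
      real (card {x. t < cmod (g x / c)}) \<le> K * cmod c powr (- r) * t powr (- r)"
    using assms(1) t assms(2) unfolding weak_type_def
    by (metis mult_pos_pos zero_less_norm_iff)
qed

lemma weak_type_card_le:
  assumes "weak_type r K g" "t > 0"
  shows "real (card {x\<in>S. cmod (g x) > t}) \<le> K * t powr (- r)"
proof -
  have "card {x\<in>S. cmod (g x) > t} \<le> card {x. cmod (g x) > t}"
    using assms by (intro card_mono) (auto simp: weak_type_def)
  then show ?thesis using assms unfolding weak_type_def by (meson of_nat_le_iff order_trans)
qed

subsection \<open>Geodesics and spheres in a homogeneous tree\<close>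

locale htree =
  fixes E :: "'v \<Rightarrow> 'v \<Rightarrow> bool" and q :: nat
  assumes tree: "homogeneous_tree E q" and q: "q \<ge> 2"
begin

abbreviation gd :: "'v \<Rightarrow> 'v \<Rightarrow> nat" where "gd \<equiv> gdist E"

definition reduced :: "nat \<Rightarrow> (nat \<Rightarrow> 'v) \<Rightarrow> bool" where
  "reduced n w \<longleftrightarrow> walk E n w \<and> (\<forall>i. i + 1 < n \<longrightarrow> w (i + 2) \<noteq> w i)"

lemma E_sym: "E x y \<Longrightarrow> E y x"
  using tree unfolding homogeneous_tree_def by meson

lemma connected: "\<exists>n w. walk E n w \<and> w 0 = x \<and> w n = y"
  using tree unfolding homogeneous_tree_def by meson

lemma no_reduced_closed: "reduced n w \<Longrightarrow> w n = w 0 \<Longrightarrow> n = 0"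
  using tree unfolding homogeneous_tree_def reduced_def by (metis One_nat_def Suc_leI gr0I)

lemma finite_nbrs [simp]: "finite {y. E x y}"
  using tree unfolding homogeneous_tree_def by meson

lemma card_nbrs: "card {y. E x y} = q + 1"
  using tree unfolding homogeneous_tree_def by meson

lemma reduced_mono: "reduced n w \<Longrightarrow> m \<le> n \<Longrightarrow> reduced m w"
  by (auto simp: reduced_def walk_def)

text \<open>The second walk is traversed backwards. The last hypothesis excludes backtracking at the
  meeting point; elsewhere reducedness is inherited from the two pieces.\<close>

lemma reduced_join:
  assumes "reduced n w" "reduced m v" "w n = v m" "n \<ge> 1" "m \<ge> 1" "w (n - 1) \<noteq> v (m - 1)"
  shows "reduced (n + m) (\<lambda>i. if i \<le> n then w i else v (n + m - i))"
  unfolding reduced_def walk_def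
proof (intro conjI allI impI)
  fix i assume i: "i < n + m"
  show "E (if i \<le> n then w i else v (n + m - i)) (if Suc i \<le> n then w (Suc i) else v (n + m - Suc i))"
  proof (cases "Suc i \<le> n")
    case True then show ?thesis using assms(1) by (auto simp: reduced_def walk_def)
  next
    case False
    have "n + m - Suc i < m" "Suc (n + m - Suc i) = n + m - i" using i False by auto
    then have "E (v (n + m - Suc i)) (v (n + m - i))"
      using assms(2) unfolding reduced_def walk_def by metis
    then show ?thesis using False assms(3) E_sym by (auto simp: not_less_eq_eq le_Suc_eq)
  qed
next
  fix i assume i: "i + 1 < n + m"
  consider "i + 2 \<le> n" | "i + 1 = n" | "n \<le> i" by linarith
  then show "(if i + 2 \<le> n then w (i + 2) else v (n + m - (i + 2))) \<noteq> (if i \<le> n then w i else v (n + m - i))"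
  proof cases
    case 1 then show ?thesis using assms(1) by (auto simp: reduced_def)
  next
    case 2
    then have "i = n - 1" "n + m - (i + 2) = m - 1" by auto
    then show ?thesis using assms(6) 2 by auto
  next
    case 3
    have "n + m - i = (n + m - (i + 2)) + 2" "(n + m - (i + 2)) + 1 < m \<or> n + m - (i + 2) + 2 = m"
      using 3 i by auto
    moreover have "\<And>j. j + 1 < m \<Longrightarrow> v (j + 2) \<noteq> v j" using assms(2) by (auto simp: reduced_def)
    ultimately have "v (n + m - i) \<noteq> v (n + m - (i + 2))"
      by (metis add_less_cancel_left one_less_numeral_iff semiring_norm(76))
    then show ?thesis using 3 assms(3) by (auto simp: le_Suc_eq)
  qed
qed

text \<open>If the last steps agree, both are dropped. If they differ, going along \<open>w\<close>
  and back along \<open>v\<close> is a nonempty closed walk without backtracking, which a tree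
  excludes.\<close>

lemma reduced_length_unique:
  "reduced n w \<Longrightarrow> reduced m v \<Longrightarrow> w 0 = v 0 \<Longrightarrow> w n = v m \<Longrightarrow> n = m"
proof (induction "n" arbitrary: m)
  case 0
  then show ?case using no_reduced_closed[of m v] by simp
next
  case (Suc n)
  have "m \<noteq> 0"
  proof
    assume "m = 0"
    then show False using no_reduced_closed[of "Suc n" w] Suc.prems by simp
  qed
  then obtain k where k: "m = Suc k" by (cases m) auto
  show ?case
  proof (cases "w n = v k")
    case True
    then show ?thesis using Suc.IH[of k] Suc.prems k reduced_mono by (metis le_SucI order_refl)
  next
    case False
    have "reduced (Suc n + m) (\<lambda>i. if i \<le> Suc n then w i else v (Suc n + m - i))"
      using reduced_join[of "Suc n" w m v] Suc.prems False k by auto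
    from no_reduced_closed[OF this] show ?thesis using Suc.prems k by auto
  qed
qed

text \<open>A shortest walk cannot backtrack: cutting out a step and its reversal would give a walk
  with the same ends that is shorter by two.\<close>

lemma minimal_walk:
  obtains w where "reduced (gd x y) w" "w 0 = x" "w (gd x y) = y"
proof -
  let ?P = "\<lambda>n. \<exists>w. walk E n w \<and> w 0 = x \<and> w n = y"
  have "\<exists>n. ?P n" using connected by blast
  then have "?P (gd x y)" unfolding gdist_def by (rule LeastI_ex)
  then obtain w where w: "walk E (gd x y) w" "w 0 = x" "w (gd x y) = y" by blast
  have least: "\<And>n. ?P n \<Longrightarrow> gd x y \<le> n" unfolding gdist_def by (rule Least_le)
  have "w (i + 2) \<noteq> w i" if i: "i + 1 < gd x y" for i
  proof
    assume eq: "w (i + 2) = w i"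
    let ?u = "\<lambda>j. if j \<le> i then w j else w (j + 2)"
    have "walk E (gd x y - 2) ?u"
      unfolding walk_def
    proof (intro allI impI)
      fix j assume j: "j < gd x y - 2"
      consider "j < i" | "j = i" | "j > i" by linarith
      then show "E (?u j) (?u (Suc j))"
      proof cases
        case 2
        have "E (w (i + 2)) (w (Suc (i + 2)))" using w(1) j 2 by (auto simp: walk_def)
        then show ?thesis using eq 2 by simp
      qed (use w(1) j in \<open>auto simp: walk_def\<close>)
    qed
    moreover have "?u 0 = x" using w by simp
    moreover have "?u (gd x y - 2) = y"
    proof (cases "gd x y - 2 \<le> i")
      case True
      then have "gd x y = i + 2" using i by simp
      then show ?thesis using w eq by simp
    next
      case False
      then have "gd x y - 2 + 2 = gd x y" by simp
      then show ?thesis using False w by simp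
    qed
    ultimately have "gd x y \<le> gd x y - 2" using least by blast
    then show False using i by simp
  qed
  then show ?thesis using that w by (auto simp: reduced_def)
qed

text \<open>A minimal walk is reduced, so uniqueness of lengths lets any walk without backtracking
  certify a distance. Later distances are computed by exhibiting such walks.\<close>

lemma gd_reduced:
  assumes "reduced n w"
  shows "gd (w 0) (w n) = n"
proof -
  obtain v where "reduced (gd (w 0) (w n)) v" "v 0 = w 0" "v (gd (w 0) (w n)) = w n"
    by (rule minimal_walk)
  then show ?thesis using reduced_length_unique assms by metis
qed

lemma gd_self [simp]: "gd x x = 0"
  using gd_reduced[of 0 "\<lambda>_. x"] by (auto simp: reduced_def walk_def)

lemma gd_eq_0 [simp]: "gd x y = 0 \<longleftrightarrow> x = y"
proof
  assume "gd x y = 0"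
  then show "x = y" using minimal_walk[of x y] by metis
qed simp

lemma gd_le_walk: "walk E n w \<Longrightarrow> gd (w 0) (w n) \<le> n"
  unfolding gdist_def by (rule Least_le) blast

lemma gd_sym: "gd x y = gd y x"
proof -
  have "gd y x \<le> gd x y" for x y
  proof -
    obtain w where w: "reduced (gd x y) w" "w 0 = x" "w (gd x y) = y" by (rule minimal_walk)
    have "walk E (gd x y) (\<lambda>i. w (gd x y - i))"
      unfolding walk_def
    proof (intro allI impI)
      fix i assume "i < gd x y"
      then have "E (w (gd x y - Suc i)) (w (Suc (gd x y - Suc i)))" "Suc (gd x y - Suc i) = gd x y - i"
        using w(1) by (auto simp: reduced_def walk_def)
      then show "E (w (gd x y - i)) (w (gd x y - Suc i))" using E_sym by simp
    qed
    from gd_le_walk[OF this] show ?thesis using w by simp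
  qed
  then show ?thesis by (simp add: order_antisym)
qed

lemma gd_triangle: "gd x z \<le> gd x y + gd y z"
proof -
  obtain w where w: "reduced (gd x y) w" "w 0 = x" "w (gd x y) = y" by (rule minimal_walk)
  obtain v where v: "reduced (gd y z) v" "v 0 = y" "v (gd y z) = z" by (rule minimal_walk)
  let ?u = "\<lambda>i. if i \<le> gd x y then w i else v (i - gd x y)"
  have "walk E (gd x y + gd y z) ?u"
    unfolding walk_def
  proof (intro allI impI)
    fix i assume i: "i < gd x y + gd y z"
    consider "i < gd x y" | "i = gd x y" | "i > gd x y" by linarith
    then show "E (?u i) (?u (Suc i))"
    proof cases
      case 1 then show ?thesis using w(1) by (auto simp: reduced_def walk_def)
    next
      case 2
      have "E (v 0) (v (Suc 0))" using v(1) i 2 by (auto simp: reduced_def walk_def)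
      then show ?thesis using 2 w v by simp
    next
      case 3
      have "E (v (i - gd x y)) (v (Suc (i - gd x y)))" using v(1) i 3 by (auto simp: reduced_def walk_def)
      then show ?thesis using 3 by (simp add: Suc_diff_le)
    qed
  qed
  from gd_le_walk[OF this] show ?thesis using w v by (auto split: if_splits)
qed

lemma gd_eq_1: "gd x y = 1 \<longleftrightarrow> E x y"
proof
  assume 1: "gd x y = 1"
  obtain w where w: "reduced (gd x y) w" "w 0 = x" "w (gd x y) = y" by (rule minimal_walk)
  then show "E x y" using 1 by (auto simp: reduced_def walk_def)
next
  assume "E x y"
  then have "reduced 1 (\<lambda>i. if i = 0 then x else y)" by (auto simp: reduced_def walk_def)
  from gd_reduced[OF this] show "gd x y = 1" by simp
qed

text \<open>The penultimate vertex of the geodesic from \<open>b\<close> to \<open>x\<close> is the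
  neighbour closer to \<open>b\<close>. Appending any other neighbour of \<open>x\<close> does not
  backtrack, so it gives a geodesic longer by one.\<close>

lemma parent_ex:
  assumes "x \<noteq> b"
  shows "\<exists>y. E x y \<and> gd b x = Suc (gd b y) \<and> (\<forall>u. E x u \<longrightarrow> u \<noteq> y \<longrightarrow> gd b u = Suc (gd b x))"
proof -
  obtain w where w: "reduced (gd b x) w" "w 0 = b" "w (gd b x) = x" by (rule minimal_walk)
  obtain n where n: "gd b x = Suc n" using assms by (metis gd_eq_0 not0_implies_Suc)
  have 1: "E x (w n)" using w n E_sym by (auto simp: reduced_def walk_def)
  have 2: "gd b (w n) = n" using gd_reduced[of n w] w n reduced_mono by (metis le_SucI order_refl)
  have "gd b u = Suc (gd b x)" if u: "E x u" "u \<noteq> w n" for u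
  proof -
    let ?v = "w(Suc (Suc n) := u)"
    have "reduced (Suc (Suc n)) ?v"
      unfolding reduced_def walk_def
    proof (intro conjI allI impI)
      fix i assume "i < Suc (Suc n)"
      then show "E (?v i) (?v (Suc i))"
        using w n u by (cases "i = Suc n") (auto simp: reduced_def walk_def)
    next
      fix i assume "i + 1 < Suc (Suc n)"
      then show "?v (i + 2) \<noteq> ?v i"
        using w n u by (cases "i = n") (auto simp: reduced_def)
    qed
    from gd_reduced[OF this] show ?thesis using w n by simp
  qed
  then show ?thesis using 1 2 n by metis
qed

section \<open>Parents, children and spheres around a base vertex\<close>

definition par :: "'v \<Rightarrow> 'v \<Rightarrow> 'v" where
  "par b x = (SOME y. E x y \<and> gd b x = Suc (gd b y) \<and>
     (\<forall>u. E x u \<longrightarrow> u \<noteq> y \<longrightarrow> gd b u = Suc (gd b x)))"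

definition children :: "'v \<Rightarrow> 'v \<Rightarrow> 'v set" where
  "children b x = {y. E x y \<and> gd b y = Suc (gd b x)}"

definition sphere :: "'v \<Rightarrow> nat \<Rightarrow> 'v set" where
  "sphere b n = {x. gd b x = n}"

lemma par:
  assumes "x \<noteq> b"
  shows "E x (par b x)" "gd b x = Suc (gd b (par b x))"
    "\<And>u. E x u \<Longrightarrow> u \<noteq> par b x \<Longrightarrow> gd b u = Suc (gd b x)"
  using someI_ex[OF parent_ex[OF assms]] unfolding par_def[symmetric] by blast+

text \<open>All neighbours other than the parent are farther from \<open>b\<close>, so adjacency and
  being one step closer identify the parent without unfolding the choice operator.\<close>

lemma par_eqI: "E x y \<Longrightarrow> gd b x = Suc (gd b y) \<Longrightarrow> par b x = y"
  using par(3)[of x b y] by (cases "x = b") auto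

lemma nbrs_root: "{y. E b y} = children b b"
  using gd_eq_1 by (auto simp: children_def)

lemma nbrs_eq: "x \<noteq> b \<Longrightarrow> {y. E x y} = insert (par b x) (children b x)"
  using par[of x b] by (auto simp: children_def)

lemma par_notin_children: "x \<noteq> b \<Longrightarrow> par b x \<notin> children b x"
  using par[of x b] by (auto simp: children_def)

lemma finite_children [simp]: "finite (children b x)"
  by (rule finite_subset[OF _ finite_nbrs[of x]]) (auto simp: children_def)

lemma card_children: "card (children b x) = (if x = b then q + 1 else q)"
proof (cases "x = b")
  case True then show ?thesis using card_nbrs[of b] nbrs_root by simp
next
  case False
  then show ?thesis using card_nbrs[of x] nbrs_eq[OF False] par_notin_children[OF False] by simp
qed

lemma children_iff: "y \<in> children b x \<longleftrightarrow> y \<noteq> b \<and> par b y = x"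
proof
  assume "y \<in> children b x"
  then show "y \<noteq> b \<and> par b y = x"
    using par_eqI[of y x b] E_sym by (auto simp: children_def)
next
  assume "y \<noteq> b \<and> par b y = x"
  then show "y \<in> children b x" using par[of y b] E_sym by (auto simp: children_def)
qed

lemma disjoint_children: "x \<noteq> y \<Longrightarrow> children b x \<inter> children b y = {}"
  by (auto simp: children_iff)

lemma sphere_0 [simp]: "sphere b 0 = {b}"
  by (auto simp: sphere_def)

lemma sphere_Suc: "sphere b (Suc n) = (\<Union>x\<in>sphere b n. children b x)"
proof (intro set_eqI iffI)
  fix y assume y: "y \<in> sphere b (Suc n)"
  then have "y \<noteq> b" by (auto simp: sphere_def)
  then have "y \<in> children b (par b y)" "par b y \<in> sphere b n"
    using par[of y b] y by (auto simp: children_iff sphere_def)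
  then show "y \<in> (\<Union>x\<in>sphere b n. children b x)" by blast
qed (auto simp: sphere_def children_def)

lemma finite_sphere [simp]: "finite (sphere b n)"
  by (induction n) (auto simp: sphere_Suc)

lemma sum_sphere_Suc:
  "(\<Sum>y\<in>sphere b (Suc n). h y) = (\<Sum>x\<in>sphere b n. \<Sum>y\<in>children b x. h y)"
  unfolding sphere_Suc by (rule sum.UNION_disjoint) (auto simp: disjoint_children)

lemma card_sphere: "card (sphere b (Suc n)) = (q + 1) * q ^ n"
proof (induction n)
  case 0
  show ?case using sum_sphere_Suc[of "\<lambda>_. 1::nat" b 0] by (simp add: card_children)
next
  case (Suc n)
  have "card (sphere b (Suc (Suc n))) = (\<Sum>x\<in>sphere b (Suc n). card (children b x))"
    using sum_sphere_Suc[of "\<lambda>_. 1::nat" b "Suc n"] by simp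
  also have "\<dots> = (\<Sum>x\<in>sphere b (Suc n). q)"
    by (rule sum.cong) (auto simp: card_children sphere_def)
  finally show ?case using Suc by (simp add: algebra_simps)
qed

lemma sum_nbrs:
  "x \<noteq> b \<Longrightarrow> (\<Sum>y\<in>{y. E x y}. h y) = h (par b x) + (\<Sum>y\<in>children b x. h y)"
  by (simp add: nbrs_eq par_notin_children)

lemma sum_sphere_par:
  "(\<Sum>y\<in>sphere b (Suc n). h (par b y)) = (\<Sum>x\<in>sphere b n. of_nat (if x = b then q + 1 else q) * (h x :: complex))"
  unfolding sum_sphere_Suc
proof (rule sum.cong)
  fix x assume "x \<in> sphere b n"
  have "(\<Sum>y\<in>children b x. h (par b y)) = (\<Sum>y\<in>children b x. h x)"
    by (rule sum.cong) (auto simp: children_iff)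
  then show "(\<Sum>y\<in>children b x. h (par b y)) = of_nat (if x = b then q + 1 else q) * h x"
    by (simp add: card_children)
qed simp

section \<open>The averaging operator acting on sphere sums\<close>

definition avg :: "('v \<Rightarrow> complex) \<Rightarrow> ('v \<Rightarrow> complex)" where
  "avg g x = (\<Sum>y\<in>{y. E x y}. g y) / of_nat (q + 1)"

lemma lap_avg: "lap E q g x = g x - avg g x"
  by (simp add: lap_def avg_def)

definition ssum :: "('v \<Rightarrow> complex) \<Rightarrow> 'v \<Rightarrow> nat \<Rightarrow> complex" where
  "ssum g x n = (\<Sum>y\<in>sphere x n. g y)"

lemma ssum_0 [simp]: "ssum g x 0 = g x" by (simp add: ssum_def)

lemma ssum_avg_0: "of_nat (q + 1) * ssum (avg g) x 0 = ssum g x 1"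
proof -
  have q1: "(of_nat (q + 1) :: complex) \<noteq> 0" unfolding of_nat_eq_0_iff by simp
  have "ssum g x 1 = (\<Sum>y\<in>children x x. g y)"
    using sum_sphere_Suc[of g x 0] by (simp add: ssum_def)
  then show ?thesis using q1 unfolding ssum_0 avg_def nbrs_root
    by (metis nonzero_mult_div_cancel_left times_divide_eq_right)
qed

text \<open>Edges between consecutive spheres are counted from both sides. The children of the
  vertices at distance \<open>n + 1\<close> exhaust the next sphere, each once. A vertex at distance
  \<open>n\<close> occurs as a parent once per child, that is \<open>q\<close> times, or
  \<open>q + 1\<close> times at the centre.\<close>

lemma ssum_avg_Suc:
  "of_nat (q + 1) * ssum (avg g) x (Suc n) =
     ssum g x (Suc (Suc n)) + of_nat (if n = 0 then q + 1 else q) * ssum g x n"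
proof -
  have q1: "(of_nat (q + 1) :: complex) \<noteq> 0" unfolding of_nat_eq_0_iff by simp
  have "of_nat (q + 1) * ssum (avg g) x (Suc n) = (\<Sum>y\<in>sphere x (Suc n). \<Sum>u\<in>{u. E y u}. g u)"
    unfolding ssum_def sum_distrib_left avg_def using q1 by (simp del: of_nat_add of_nat_Suc)
  also have "\<dots> = (\<Sum>y\<in>sphere x (Suc n). g (par x y) + (\<Sum>u\<in>children x y. g u))"
    by (intro sum.cong refl sum_nbrs) (auto simp: sphere_def)
  also have "\<dots> = (\<Sum>y\<in>sphere x (Suc n). g (par x y)) + ssum g x (Suc (Suc n))"
    by (simp add: sum.distrib ssum_def sum_sphere_Suc[of g x "Suc n"])
  also have "(\<Sum>y\<in>sphere x (Suc n). g (par x y)) = of_nat (if n = 0 then q + 1 else q) * ssum g x n"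
    unfolding sum_sphere_par ssum_def sum_distrib_left
    by (rule sum.cong) (auto simp: sphere_def)
  finally show ?thesis by simp
qed

subsection \<open>Sphere sums and the eigenvalue equation\<close>

lemma q_pos: "real q > 0" "real q \<ge> 1" using q by auto

text \<open>The value at 0 is lowered from 1 so that
  \<open>(q + 1) * sphere_majorant \<beta> 0 = q\<close>. This absorbs the extra child of the centre
  and gives the recursion for sphere sums the same form at every positive radius.\<close>

definition sphere_majorant :: "real \<Rightarrow> nat \<Rightarrow> real" where
  "sphere_majorant \<beta> n = (if n = 0 then real q / (real q + 1) else \<beta> ^ n)"

definition ssum_bounded :: "real \<Rightarrow> real \<Rightarrow> ('v \<Rightarrow> complex) \<Rightarrow> bool" where
  "ssum_bounded \<beta> K g \<longleftrightarrow> (\<forall>x n. cmod (ssum g x n) \<le> K * sphere_majorant \<beta> n)"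

lemma ssum_boundedD: "ssum_bounded \<beta> K g \<Longrightarrow> K \<ge> 0 \<Longrightarrow> cmod (g x) \<le> K"
proof -
  assume K: "ssum_bounded \<beta> K g" "K \<ge> 0"
  have "cmod (ssum g x 0) \<le> K * (real q / (real q + 1))"
    using K(1) unfolding ssum_bounded_def sphere_majorant_def by (metis (full_types))
  also have "\<dots> \<le> K * 1" using K(2) by (intro mult_left_mono) auto
  finally show ?thesis by simp
qed

text \<open>At positive radius the estimate is the identity \<open>(\<alpha> + \<beta>) * \<beta> ^
  (m + 1) = \<beta> ^ (m + 2) + q * \<beta> ^ m\<close>, a consequence of
  \<open>\<alpha> * \<beta> = q\<close>. No constant is lost, which is what keeps all iterates
  bounded after division by powers of \<open>(\<alpha> + \<beta>) / (q + 1)\<close>.\<close>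

lemma ssum_bounded_avg:
  assumes "ssum_bounded \<beta> K g" "K \<ge> 0" "\<alpha> * \<beta> = real q" "\<alpha> \<ge> 1" "\<beta> \<ge> 1"
  shows "ssum_bounded \<beta> ((\<alpha> + \<beta>) / (real q + 1) * K) (avg g)"
  unfolding ssum_bounded_def
proof (intro allI)
  fix x n
  let ?\<psi> = "sphere_majorant \<beta>"
  have B: "cmod (ssum g x m) \<le> K * ?\<psi> m" for m using assms(1) by (auto simp: ssum_bounded_def)
  have "(real q + 1) * cmod (ssum (avg g) x n) \<le> (\<alpha> + \<beta>) * (K * ?\<psi> n)"
  proof (cases n)
    case 0
    have "(real q + 1) * cmod (ssum (avg g) x 0) = cmod (of_nat (q + 1) * ssum (avg g) x 0)"
      unfolding norm_mult norm_of_nat by simp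
    also have "\<dots> \<le> K * \<beta>"
      using B[of 1] unfolding ssum_avg_0 by (simp add: sphere_majorant_def)
    also have "\<dots> \<le> K * ((\<alpha> + \<beta>) * (real q / (real q + 1)))"
    proof (intro mult_left_mono assms(2))
      \<comment> \<open>At the centre the lowered value of the majorant has to be paid for. The
        required inequality reduces to \<open>\<beta> \<le> \<alpha> * q\<close>, which follows from
        \<open>\<beta> \<le> \<alpha> * \<beta>\<close> and \<open>\<beta> \<le> q\<close>.\<close>
      have "\<beta> \<le> \<alpha> * \<beta>" "1 * \<alpha> \<le> real q * \<alpha>"
        using assms(4,5) q_pos by (auto intro!: mult_right_mono)
      moreover have "\<alpha> * \<beta> \<le> \<alpha> * real q"
      proof -
        have "\<beta> \<le> real q" using \<open>\<beta> \<le> \<alpha> * \<beta>\<close> assms(3) by simp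
        then show ?thesis using assms(4) by (intro mult_left_mono) auto
      qed
      ultimately have "\<beta> * (real q + 1) \<le> (\<alpha> + \<beta>) * real q"
        by (simp add: algebra_simps)
      then show "\<beta> \<le> (\<alpha> + \<beta>) * (real q / (real q + 1))"
        by (simp add: pos_le_divide_eq)
    qed
    finally show ?thesis using 0 by (simp add: sphere_majorant_def mult_ac)
  next
    case (Suc m)
    have "(real q + 1) * cmod (ssum (avg g) x (Suc m)) = cmod (of_nat (q + 1) * ssum (avg g) x (Suc m))"
      unfolding norm_mult norm_of_nat by simp
    also have "\<dots> \<le> cmod (ssum g x (Suc (Suc m))) + real (if m = 0 then q + 1 else q) * cmod (ssum g x m)"
      unfolding ssum_avg_Suc by (rule order_trans[OF norm_triangle_ineq]) (simp only: norm_mult norm_of_nat order_refl)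
    also have "\<dots> \<le> K * ?\<psi> (Suc (Suc m)) + real (if m = 0 then q + 1 else q) * (K * ?\<psi> m)"
      by (intro add_mono mult_left_mono B) auto
    also have "\<dots> = K * (\<beta> * \<beta> ^ Suc m + real q * \<beta> ^ m)"
      using q_pos by (auto simp: sphere_majorant_def algebra_simps divide_simps)
    also have "\<dots> = (\<alpha> + \<beta>) * (K * ?\<psi> n)"
      using Suc by (simp add: sphere_majorant_def assms(3)[symmetric] algebra_simps)
    finally show ?thesis using Suc by simp
  qed
  then show "cmod (ssum (avg g) x n) \<le> (\<alpha> + \<beta>) / (real q + 1) * K * ?\<psi> n"
    by (simp add: field_simps)
qed

lemma ssum_bounded_funpow_avg:
  assumes "ssum_bounded \<beta> K g" "K \<ge> 0" "\<alpha> * \<beta> = real q" "\<alpha> \<ge> 1" "\<beta> \<ge> 1"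
  shows "ssum_bounded \<beta> (((\<alpha> + \<beta>) / (real q + 1)) ^ i * K) ((avg ^^ i) g)"
proof (induction i)
  case (Suc i)
  show ?case
    using ssum_bounded_avg[OF Suc _ assms(3-5)] assms by (simp add: mult_ac)
qed (use assms in simp)

lemma avg_linear: "avg (\<lambda>x. c * g x + d * h x) = (\<lambda>x. c * avg g x + d * avg h x)"
  by (auto simp: avg_def sum.distrib sum_distrib_left[symmetric] add_divide_distrib)

lemma funpow_avg_linear:
  "(avg ^^ i) (\<lambda>x. c * g x + d * h x) = (\<lambda>x. c * (avg ^^ i) g x + d * (avg ^^ i) h x)"
  by (induction i) (auto simp: avg_linear)

lemma card_sphere_le: "real (card (sphere x n)) \<le> 2 * real q ^ n"
proof (cases n)
  case (Suc m)
  have "real q ^ m \<le> real q * real q ^ m" using q_pos by simp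
  then show ?thesis using Suc by (simp add: card_sphere algebra_simps)
qed simp

lemma card_sphere_ge: "real q ^ n \<le> real (card (sphere x n))"
  by (cases n) (auto simp: card_sphere algebra_simps)

text \<open>A sphere has about \<open>q ^ n\<close> points, so \<open>weak_type_sum\<close> yields
  growth of order \<open>(q powr (1 - 1 / r)) ^ n\<close>. In the factor 4, one 2 pays for
  \<open>card_sphere_le\<close> and the other for the value of the majorant at 0, which is at least
  1/2.\<close>

lemma ssum_bounded_if_weak_type:
  assumes "weak_type r K g" "K \<ge> 0" "r > 2"
  shows "ssum_bounded (real q powr (1 - 1 / r)) (4 * sqrt (1 + 4 * K / (1 - 2 powr (2 - r)))) g"
  unfolding ssum_bounded_def
proof (intro allI)
  fix x n
  let ?C = "sqrt (1 + 4 * K / (1 - 2 powr (2 - r)))" and ?s = "1 - 1 / r"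
  have "(2::real) powr (2 - r) < 1" using assms(3) by (simp add: powr_less_one)
  then have C: "?C \<ge> 0" using assms(2) by simp
  have s: "0 \<le> ?s" "?s \<le> 1" using assms(3) by auto
  have "cmod (ssum g x n) \<le> (\<Sum>y\<in>sphere x n. cmod (g y))"
    unfolding ssum_def by (rule norm_sum)
  also have "\<dots> \<le> ?C * real (card (sphere x n)) powr ?s"
    using weak_type_card_le[OF assms(1)] assms by (intro weak_type_sum) auto
  also have "\<dots> \<le> ?C * (2 * real q ^ n) powr ?s"
    using C s card_sphere_le by (intro mult_left_mono powr_mono2) auto
  also have "\<dots> = ?C * 2 powr ?s * (real q powr ?s) ^ n"
    using q_pos by (simp add: powr_mult powr_realpow[symmetric] powr_powr mult_ac)
  also have "\<dots> \<le> ?C * 2 * (2 * sphere_majorant (real q powr ?s) n)"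
  proof (intro mult_mono)
    show "(real q powr ?s) ^ n \<le> 2 * sphere_majorant (real q powr ?s) n"
      using q_pos by (auto simp: sphere_majorant_def field_simps)
    show "2 powr ?s \<le> (2::real)" using powr_mono[of ?s 1 2] s by simp
  qed (use C in auto)
  finally show "cmod (ssum g x n) \<le> 4 * ?C * sphere_majorant (real q powr ?s) n" by simp
qed

text \<open>The orbit relation says that \<open>g m\<close> is
  \<open>(1 - \<rho>) * g (Suc m) + avg (g m)\<close>. Applying \<open>avg\<close> repeatedly and
  dividing by powers of \<open>\<rho>\<close> gives a space-time harmonic array with
  \<open>a = \<rho>\<close>, bounded because \<open>avg\<close> divided by \<open>\<rho>\<close> is
  a contraction. The conclusion \<open>D 0 1 = D 1 0\<close> reads
  \<open>g 1 = avg (g 0) / \<rho>\<close>; inserting this into the relation for \<open>m = 0\<close>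
  gives the eigenvalue equation.\<close>

lemma eigenfunction_if_forward_orbit:
  assumes ab: "\<alpha> * \<beta> = real q" "\<alpha> > 1" "\<beta> > 1" and \<rho>: "\<rho> = (\<alpha> + \<beta>) / (real q + 1)"
    and bd: "\<And>m. ssum_bounded \<beta> K (g m)" and K: "K \<ge> 0"
    and orbit: "\<And>m. lap E q (g m) = (\<lambda>x. (1 - of_real \<rho>) * g (Suc m) x)"
  shows "avg (g 0) x = of_real \<rho> * g 0 x"
proof -
  \<comment> \<open>With \<open>\<alpha> * \<beta> = q\<close> this product expands to
    \<open>\<alpha> + \<beta> < q + 1\<close>, so \<open>\<rho>\<close> can serve as a transition
    probability.\<close>
  have "(\<alpha> - 1) * (\<beta> - 1) > 0" using ab by simp
  then have \<rho>1: "0 < \<rho>" "\<rho> < 1" using ab q_pos by (auto simp: \<rho> algebra_simps)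
  define D where "D i m = (avg ^^ i) (g m) x / of_real \<rho> ^ i" for i m
  have bdD: "cmod (D i m) \<le> K" for i m
  proof -
    have "cmod ((avg ^^ i) (g m) x) \<le> \<rho> ^ i * K"
      using ssum_bounded_funpow_avg[OF bd K ab(1)] ab K \<rho>1 unfolding \<rho>[symmetric]
      by (intro ssum_boundedD) auto
    then show ?thesis using \<rho>1 by (simp add: D_def norm_divide norm_power field_simps)
  qed
  have step: "g m = (\<lambda>x. (1 - of_real \<rho>) * g (Suc m) x + 1 * avg (g m) x)" for m
    using fun_cong[OF orbit[of m]] by (auto simp: lap_avg fun_eq_iff algebra_simps)
  have *: "(avg ^^ i) (g m) x = (1 - of_real \<rho>) * (avg ^^ i) (g (Suc m)) x + (avg ^^ Suc i) (g m) x" for i m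
    by (subst (1) step, subst funpow_avg_linear) (simp only: funpow_Suc_right o_apply mult_1_left)
  have "D i m = of_real (1 - \<rho>) * D i (Suc m) + of_real \<rho> * D (Suc i) m" for i m
    unfolding D_def using *[of i m] \<rho>1 by (simp add: field_simps)
  from bounded_space_time_harmonic[where D = D, OF \<rho>1 bdD this, of 0 0]
  have 1: "g 1 x = avg (g 0) x / of_real \<rho>" by (simp add: D_def)
  moreover have "g 0 x = (1 - of_real \<rho>) * g 1 x + avg (g 0) x"
    using *[of 0 0] by simp
  ultimately show ?thesis using \<rho>1 by (simp add: field_simps)
qed

text \<open>Here \<open>g m\<close> is \<open>(g (Suc m) - avg (g (Suc m))) / (1 + \<rho>)\<close>,
  with both terms at the later index. The diagonal shift \<open>m + i\<close> in \<open>D\<close>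
  accounts for that, and dividing by powers of \<open>- \<rho>\<close> makes the two weights
  positive with sum 1. The array yields the equation for \<open>g 1\<close>; the orbit relation then
  shows that \<open>g 0\<close> and \<open>g 1\<close> agree.\<close>

lemma eigenfunction_if_backward_orbit:
  assumes ab: "\<alpha> * \<beta> = real q" "\<alpha> > 1" "\<beta> > 1" and \<rho>: "\<rho> = (\<alpha> + \<beta>) / (real q + 1)"
    and bd: "\<And>m. ssum_bounded \<beta> K (g m)" and K: "K \<ge> 0"
    and orbit: "\<And>m. lap E q (g (Suc m)) = (\<lambda>x. (1 + of_real \<rho>) * g m x)"
  shows "avg (g 1) x = - of_real \<rho> * g 1 x" and "g 0 x = g 1 x"
proof -
  have \<rho>0: "0 < \<rho>" using ab q_pos by (auto simp: \<rho>)
  define a where "a = \<rho> / (1 + \<rho>)"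
  have a: "0 < a" "a < 1" using \<rho>0 by (auto simp: a_def)
  have c: "1 + of_real \<rho> \<noteq> (0::complex)"
    using \<rho>0 by (metis add_pos_pos less_numeral_extra(1,3) of_real_1 of_real_add of_real_eq_0_iff)
  define D where "D i m = (avg ^^ i) (g (m + i)) x / (- of_real \<rho>) ^ i" for i m
  have bdD: "cmod (D i m) \<le> K" for i m
  proof -
    have "cmod ((avg ^^ i) (g (m + i)) x) \<le> \<rho> ^ i * K"
      using ssum_bounded_funpow_avg[OF bd K ab(1)] ab K \<rho>0 unfolding \<rho>[symmetric]
      by (intro ssum_boundedD) auto
    then show ?thesis using \<rho>0 by (simp add: D_def norm_divide norm_power field_simps)
  qed
  have gm: "(1 + of_real \<rho>) * g m y = g (Suc m) y - avg (g (Suc m)) y" for m y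
    using fun_cong[OF orbit[of m]] by (simp add: lap_avg)
  have step: "g m = (\<lambda>x. (1 / (1 + of_real \<rho>)) * g (Suc m) x + (- 1 / (1 + of_real \<rho>)) * avg (g (Suc m)) x)" for m
  proof
    fix y show "g m y = (1 / (1 + of_real \<rho>)) * g (Suc m) y + (- 1 / (1 + of_real \<rho>)) * avg (g (Suc m)) y"
      using gm[of m y] c by (simp add: divide_simps) (simp add: algebra_simps)
  qed
  have *: "(avg ^^ i) (g m) x = (1 / (1 + of_real \<rho>)) * (avg ^^ i) (g (Suc m)) x
      + (- 1 / (1 + of_real \<rho>)) * (avg ^^ Suc i) (g (Suc m)) x" for i m
    by (subst (1) step, subst funpow_avg_linear) (simp only: funpow_Suc_right o_apply)
  have "D i m = of_real (1 - a) * D i (Suc m) + of_real a * D (Suc i) m" for i m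
  proof -
    have a': "of_real (1 - a) = 1 / (1 + of_real \<rho> :: complex)" "of_real a = of_real \<rho> / (1 + of_real \<rho> :: complex)"
      using \<rho>0 c by (auto simp: a_def field_simps)
    show ?thesis
      unfolding D_def a' using *[of i "m + i"] \<rho>0 c by (simp add: divide_simps)
  qed
  from bounded_space_time_harmonic[where D = D, OF a bdD this, of 0 0]
  show 1: "avg (g 1) x = - of_real \<rho> * g 1 x" using \<rho>0 by (simp add: D_def field_simps)
  then have "(1 + of_real \<rho>) * g 0 x = (1 + of_real \<rho>) * g 1 x"
    using gm[of 0 x] by (simp add: algebra_simps)
  then show "g 0 x = g 1 x" using c by simp
qed

subsection \<open>Cylinders, heights and the Poisson kernel\<close>

lemma gd_nbr_cases: "E x y \<Longrightarrow> gd b y = Suc (gd b x) \<or> gd b x = Suc (gd b y)"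
  using par[of x b] gd_eq_1[of x y] by (cases "x = b"; cases "y = par b x") auto

text \<open>The first hypothesis places \<open>y\<close> on the geodesic from \<open>x\<close> to
  \<open>u\<close>, so a step from \<open>u\<close> towards \<open>y\<close> is also a step towards
  \<open>x\<close>.\<close>

lemma par_change_root:
  assumes "gd x u = gd x y + gd y u" "u \<noteq> y"
  shows "par x u = par y u"
proof (rule par_eqI)
  note p = par[OF assms(2)]
  show "E u (par y u)" by (rule p)
  have "gd x (par y u) \<le> gd x y + gd y (par y u)" by (rule gd_triangle)
  then have "gd x (par y u) < gd x u" using assms(1) p(2) by simp
  then show "gd x u = Suc (gd x (par y u))" using gd_nbr_cases[OF p(1), of x] by auto
qed

lemma boundary_0: "\<omega> \<in> boundary E b \<Longrightarrow> \<omega> 0 = b"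
  by (simp add: boundary_def)

lemma boundary_gd: "\<omega> \<in> boundary E b \<Longrightarrow> gd b (\<omega> n) = n"
  unfolding boundary_def by (metis (mono_tags, lifting) abs_of_nonneg diff_ge_0_iff_ge diff_zero mem_Collect_eq nat_int of_nat_0 gd_sym of_nat_0_le_iff)

lemma boundary_E: "\<omega> \<in> boundary E b \<Longrightarrow> E (\<omega> n) (\<omega> (Suc n))"
  by (auto simp: boundary_def gd_eq_1[symmetric])

lemma boundary_par: "\<omega> \<in> boundary E b \<Longrightarrow> par b (\<omega> (Suc n)) = \<omega> n"
  by (rule par_eqI) (simp_all add: boundary_gd E_sym boundary_E)

lemma boundary_ne: "\<omega> \<in> boundary E b \<Longrightarrow> \<omega> (Suc n) \<noteq> b"
  using boundary_gd[of \<omega> b "Suc n"] by auto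

lemma cylinder_iff: "\<omega> \<in> cylinder E b x \<longleftrightarrow> \<omega> \<in> boundary E b \<and> \<omega> (gd b x) = x"
  by (simp add: cylinder_def)

lemma cylinder_root: "cylinder E b b = boundary E b"
  by (auto simp: cylinder_iff boundary_0)

lemma cylinder_children: "cylinder E b x = (\<Union>y\<in>children b x. cylinder E b y)"
proof (intro set_eqI iffI)
  fix \<omega> assume \<omega>: "\<omega> \<in> cylinder E b x"
  then have b: "\<omega> \<in> boundary E b" and x: "\<omega> (gd b x) = x" by (auto simp: cylinder_iff)
  let ?y = "\<omega> (Suc (gd b x))"
  have "?y \<in> children b x" using boundary_par[OF b] boundary_ne[OF b] x by (auto simp: children_iff)
  moreover have "\<omega> \<in> cylinder E b ?y" using b by (auto simp: cylinder_iff boundary_gd)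
  ultimately show "\<omega> \<in> (\<Union>y\<in>children b x. cylinder E b y)" by blast
next
  fix \<omega> assume "\<omega> \<in> (\<Union>y\<in>children b x. cylinder E b y)"
  then obtain y where y: "y \<in> children b x" "\<omega> \<in> cylinder E b y" by blast
  then have "par b y = x" by (simp add: children_iff)
  with y have b: "\<omega> \<in> boundary E b" and "\<omega> (Suc (gd b x)) = y" "par b y = x"
    by (auto simp: cylinder_iff children_def)
  then show "\<omega> \<in> cylinder E b x" using boundary_par[OF b, of "gd b x"] by (auto simp: cylinder_iff)
qed

lemma cylinder_disjoint: "gd b x = gd b y \<Longrightarrow> x \<noteq> y \<Longrightarrow> cylinder E b x \<inter> cylinder E b y = {}"
  by (auto simp: cylinder_iff)

lemma cylinder_subset_par: "x \<noteq> b \<Longrightarrow> cylinder E b x \<subseteq> cylinder E b (par b x)"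
  using cylinder_children[of b "par b x"] by (auto simp: children_iff)

text \<open>A ray from \<open>b\<close> that misses \<open>x\<close> never enters the subtree below
  \<open>x\<close>, so every path from \<open>x\<close> to it runs through the parent. Inductively,
  a failing step of the ray would lead towards \<open>x\<close> and away from the parent. Starting
  at the parent, it would land on \<open>x\<close>. Starting elsewhere, the directions towards
  \<open>x\<close> and towards its parent coincide by \<open>par_change_root\<close>, a
  contradiction.\<close>

lemma gd_ray_off_cylinder:
  assumes \<omega>: "\<omega> \<in> boundary E b" "\<omega> \<notin> cylinder E b x" and x: "x \<noteq> b"
  shows "gd x (\<omega> n) = Suc (gd (par b x) (\<omega> n))"
proof (induction n)
  case 0
  show ?case using par(2)[OF x] boundary_0[OF \<omega>(1)] gd_sym[of x b] gd_sym[of "par b x" b] by simp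
next
  case (Suc n)
  let ?y = "par b x" and ?u = "\<omega> n" and ?u' = "\<omega> (Suc n)"
  have Exy: "E x ?y" by (rule par(1)[OF x])
  then have 1: "gd x ?y = 1" unfolding gd_eq_1 .
  show ?case
  proof (rule ccontr)
    assume "gd x ?u' \<noteq> Suc (gd ?y ?u')"
    then have 2: "gd ?y ?u' = Suc (gd x ?u')"
      using gd_nbr_cases[OF Exy, of ?u'] gd_sym[of ?u' x] gd_sym[of ?u' ?y] by linarith
    have Eu: "E ?u ?u'" by (rule boundary_E[OF \<omega>(1)])
    have 3: "gd x ?u = Suc (gd x ?u')" "gd ?y ?u' = Suc (gd ?y ?u)"
      using gd_nbr_cases[OF Eu, of x] gd_nbr_cases[OF Eu, of ?y] 2 Suc.IH by linarith+
    have "par x ?u = ?u'" by (rule par_eqI[OF Eu 3(1)])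
    show False
    proof (cases "?u = ?y")
      case True
      then have "gd x ?u' = 0" using Suc.IH 3 by simp
      then have "x = ?u'" by simp
      then show False using \<omega> by (auto simp: cylinder_iff boundary_gd)
    next
      case False
      have "par x ?u = par ?y ?u" using Suc.IH 1 False by (intro par_change_root) simp_all
      then have "gd ?y ?u = Suc (gd ?y ?u')" using par(2)[OF False] \<open>par x ?u = ?u'\<close> by simp
      then show False using 3 by simp
    qed
  qed
qed

lemma gd_ray_on_cylinder:
  assumes "\<omega> \<in> cylinder E b x" "n \<ge> gd b x"
  shows "gd x (\<omega> n) = n - gd b x"
proof -
  have "\<forall>m n. gd (\<omega> m) (\<omega> n) = nat \<bar>int m - int n\<bar>" and x: "\<omega> (gd b x) = x"
    using assms(1) by (simp_all add: cylinder_iff boundary_def)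
  then have "gd (\<omega> (gd b x)) (\<omega> n) = nat \<bar>int (gd b x) - int n\<bar>" by blast
  then show ?thesis unfolding x using assms(2) by simp
qed

text \<open>Induction along the chain of parents down to \<open>b\<close>: on the cylinder of
  \<open>x\<close> the eventual value is \<open>gd b x\<close>, off it the value is one less than at
  the parent.\<close>

lemma height_eventually:
  assumes "\<omega> \<in> boundary E b"
  shows "\<exists>c::int. \<forall>\<^sub>F n in sequentially. int n - int (gd x (\<omega> n)) = c"
proof (induction "gd b x" arbitrary: x)
  case 0
  then have "x = b" by (metis gd_eq_0)
  then show ?case using assms by (auto simp: boundary_gd)
next
  case (Suc m)
  then have x: "x \<noteq> b" by auto
  then obtain c where c: "\<forall>\<^sub>F n in sequentially. int n - int (gd (par b x) (\<omega> n)) = c"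
    using Suc par(2)[OF x] by (metis Suc_inject)
  show ?case
  proof (cases "\<omega> \<in> cylinder E b x")
    case True
    have "\<forall>\<^sub>F n in sequentially. int n - int (gd x (\<omega> n)) = int (gd b x)"
      using eventually_ge_at_top[of "gd b x"] by eventually_elim (simp add: gd_ray_on_cylinder[OF True])
    then show ?thesis by blast
  next
    case False
    have "\<forall>\<^sub>F n in sequentially. int n - int (gd x (\<omega> n)) = c - 1"
      using c by eventually_elim (simp add: gd_ray_off_cylinder[OF assms False x])
    then show ?thesis by blast
  qed
qed

text \<open>An integer-valued height lets powers of the Poisson kernel be treated as integer powers
  \<open>powi\<close> instead of complex \<open>powr\<close>.\<close>

definition iheight :: "'v \<Rightarrow> (nat \<Rightarrow> 'v) \<Rightarrow> 'v \<Rightarrow> int" where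
  "iheight b \<omega> x = (SOME c. \<forall>\<^sub>F n in sequentially. int n - int (gd x (\<omega> n)) = c)"

lemma iheight:
  "\<omega> \<in> boundary E b \<Longrightarrow> \<forall>\<^sub>F n in sequentially. int n - int (gd x (\<omega> n)) = iheight b \<omega> x"
  unfolding iheight_def by (rule someI_ex[OF height_eventually])

lemma iheight_eqI:
  assumes "\<omega> \<in> boundary E b" "\<forall>\<^sub>F n in sequentially. int n - int (gd x (\<omega> n)) = c"
  shows "iheight b \<omega> x = c"
proof -
  have "\<forall>\<^sub>F n in sequentially. iheight b \<omega> x = c"
    using iheight[OF assms(1), of x] assms(2) by eventually_elim simp
  then show ?thesis by simp
qed

lemma iheight_on_cylinder:
  assumes "\<omega> \<in> cylinder E b x"
  shows "iheight b \<omega> x = int (gd b x)"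
proof (rule iheight_eqI)
  show "\<forall>\<^sub>F n in sequentially. int n - int (gd x (\<omega> n)) = int (gd b x)"
    using eventually_ge_at_top[of "gd b x"] by eventually_elim (simp add: gd_ray_on_cylinder[OF assms])
qed (use assms in \<open>simp add: cylinder_iff\<close>)

lemma iheight_off_cylinder:
  assumes "\<omega> \<in> boundary E b" "\<omega> \<notin> cylinder E b x" "x \<noteq> b"
  shows "iheight b \<omega> x = iheight b \<omega> (par b x) - 1"
proof (rule iheight_eqI[OF assms(1)])
  show "\<forall>\<^sub>F n in sequentially. int n - int (gd x (\<omega> n)) = iheight b \<omega> (par b x) - 1"
    using iheight[OF assms(1), of "par b x"] by eventually_elim (simp add: gd_ray_off_cylinder[OF assms])
qed

lemma height_eq_iheight:
  assumes "\<omega> \<in> boundary E b"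
  shows "height E \<omega> x = of_int (iheight b \<omega> x)"
  unfolding height_def
proof (rule limI)
  have "\<forall>\<^sub>F n in sequentially. real n - real (gd x (\<omega> n)) = of_int (iheight b \<omega> x)"
    using iheight[OF assms, of x]
  proof eventually_elim
    case (elim n)
    then have "real_of_int (int n - int (gd x (\<omega> n))) = of_int (iheight b \<omega> x)" by simp
    then show ?case by simp
  qed
  then show "(\<lambda>n. real n - real (gd x (\<omega> n))) \<longlonglongrightarrow> of_int (iheight b \<omega> x)"
    by (rule tendsto_eventually)
qed

definition kernel_power :: "'v \<Rightarrow> complex \<Rightarrow> 'v \<Rightarrow> (nat \<Rightarrow> 'v) \<Rightarrow> complex" where
  "kernel_power b B x \<omega> = B powi iheight b \<omega> x"

text \<open>The kernel is a positive real whose principal logarithm is the height times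
  \<open>ln q\<close>, so both powers are the same exponential and no branch correction
  occurs.\<close>

lemma poisson_kernel_powr:
  assumes "\<omega> \<in> boundary E b"
  shows "of_real (poisson_kernel E q x \<omega>) powr s = kernel_power b (of_real (real q) powr s) x \<omega>"
proof -
  let ?k = "iheight b \<omega> x"
  have "(of_real (real q) powr s) powi ?k = exp (of_int ?k * (s * of_real (ln (real q))))"
    using q by (simp add: powr_def Ln_of_real exp_power_int[symmetric])
  moreover have "of_real (real q powr of_int ?k) powr s = exp (s * of_real (of_int ?k * ln (real q)))"
    using q by (simp add: powr_def Ln_of_real)
  ultimately show ?thesis
    unfolding poisson_kernel_def kernel_power_def height_eq_iheight[OF assms] by (simp add: mult_ac)
qed

text \<open>From the parent to \<open>x\<close> the height drops by one off the cylinder of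
  \<open>x\<close> and rises by one on it. Division by \<open>B\<close> is right off the cylinder;
  on it the indicator term corrects \<open>B powi (n - 2)\<close> to \<open>B ^ n\<close>, where
  \<open>n = gd b x\<close>. Integrated against \<open>F\<close>, this links the Poisson transform
  to the integrals of \<open>F\<close> over cylinders.\<close>

lemma kernel_power_step:
  assumes "\<omega> \<in> boundary E b" "x \<noteq> b" "B \<noteq> 0"
  shows "kernel_power b B x \<omega> = kernel_power b B (par b x) \<omega> / B
    + indicator (cylinder E b x) \<omega> * ((B\<^sup>2 - 1) * B ^ gd b x / B\<^sup>2)"
proof (cases "\<omega> \<in> cylinder E b x")
  case True
  then have in_par: "\<omega> \<in> cylinder E b (par b x)" using cylinder_subset_par[OF assms(2)] by blast
  have 1: "kernel_power b B (par b x) \<omega> = B ^ gd b (par b x)"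
    unfolding kernel_power_def iheight_on_cylinder[OF in_par] power_int_of_nat ..
  have 2: "kernel_power b B x \<omega> = B ^ Suc (gd b (par b x))"
    unfolding kernel_power_def iheight_on_cylinder[OF True] power_int_of_nat par(2)[OF assms(2)] ..
  have "B ^ Suc k = B ^ k / B + 1 * ((B\<^sup>2 - 1) * B ^ Suc k / B\<^sup>2)" for k
    using assms(3) by (simp add: field_simps power2_eq_square)
  then show ?thesis unfolding 1 2 par(2)[OF assms(2)] using True by simp
next
  case False
  then show ?thesis
    using assms by (simp add: kernel_power_def iheight_off_cylinder power_int_diff)
qed

lemma kernel_power_root: "\<omega> \<in> boundary E b \<Longrightarrow> kernel_power b B b \<omega> = 1"
  using iheight_on_cylinder[of \<omega> b b] by (simp add: kernel_power_def cylinder_root)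

end

subsection \<open>Martingales on the boundary\<close>

locale htree_boundary = htree +
  fixes b :: 'a and \<nu> :: "(nat \<Rightarrow> 'a) measure"
  assumes nu: "canonical_boundary_measure E q b \<nu>"
begin

sublocale prob_space \<nu>
  using nu by (simp add: canonical_boundary_measure_def)

lemma space_nu: "space \<nu> = boundary E b"
  using nu by (simp add: canonical_boundary_measure_def)

lemma cylinder_sets [measurable]: "cylinder E b x \<in> sets \<nu>"
  using nu by (auto simp: canonical_boundary_measure_def)

abbreviation scard :: "nat \<Rightarrow> real" where "scard n \<equiv> real (card (sphere b n))"

lemma scard_pos: "scard n > 0"
  using card_sphere_ge[of n b] q_pos by (metis order_less_le_trans zero_less_power)

lemma scard_Suc: "scard (Suc (gd b x)) = real (card (children b x)) * scard (gd b x)"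
  by (cases "gd b x") (auto simp: card_sphere card_children algebra_simps)

lemma measure_cylinder: "prob (cylinder E b x) = 1 / scard (gd b x)"
proof (cases "gd b x")
  case 0
  then show ?thesis using prob_space by (simp add: cylinder_root space_nu)
next
  case (Suc n)
  then have "emeasure \<nu> (cylinder E b x) = ennreal (1 / scard (gd b x))"
    using nu by (simp add: canonical_boundary_measure_def card_sphere algebra_simps)
  then show ?thesis by (simp add: measure_def)
qed

text \<open>The sigma-algebra is known only through the cylinders. Writing a function of the
  \<open>n\<close>-th vertex as a finite combination of their indicators is how its measurability,
  integrability and integral are obtained.\<close>

lemma ray_eval:
  fixes \<phi> :: "'a \<Rightarrow> 'c::real_vector"
  assumes "\<omega> \<in> space \<nu>"
  shows "\<phi> (\<omega> n) = (\<Sum>x\<in>sphere b n. indicator (cylinder E b x) \<omega> *\<^sub>R \<phi> x)"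
proof -
  have \<omega>: "\<omega> \<in> boundary E b" "\<omega> n \<in> sphere b n"
    using assms by (auto simp: space_nu sphere_def boundary_gd)
  have "(\<Sum>x\<in>sphere b n. indicator (cylinder E b x) \<omega> *\<^sub>R \<phi> x) = (\<Sum>x\<in>sphere b n. if x = \<omega> n then \<phi> x else 0)"
    using \<omega> by (intro sum.cong refl) (auto simp: cylinder_iff sphere_def indicator_def)
  then show ?thesis using \<omega> by simp
qed

lemma integrable_cylinder_indicator:
  fixes c :: "'c::{banach, second_countable_topology}"
  shows "integrable \<nu> (\<lambda>\<omega>. indicator (cylinder E b x) \<omega> *\<^sub>R c)"
  by (intro integrable_scaleR_left integrable_real_indicator) (auto simp: emeasure_finite less_top[symmetric])

lemma integral_cylinder_indicator:
  fixes c :: "'c::{banach, second_countable_topology}"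
  shows "(\<integral>\<omega>. indicator (cylinder E b x) \<omega> *\<^sub>R c \<partial>\<nu>) = prob (cylinder E b x) *\<^sub>R c"
  by (subst integral_scaleR_left)
     (auto intro!: integrable_real_indicator simp: emeasure_finite less_top[symmetric])

lemma integrable_ray [simp]:
  fixes \<phi> :: "'a \<Rightarrow> 'c::{banach, second_countable_topology}"
  shows "integrable \<nu> (\<lambda>\<omega>. \<phi> (\<omega> n))"
  by (subst Bochner_Integration.integrable_cong[OF refl ray_eval])
     (assumption, intro Bochner_Integration.integrable_sum integrable_cylinder_indicator)

lemma measurable_ray [measurable]:
  fixes \<phi> :: "'a \<Rightarrow> 'c::{banach, second_countable_topology}"
  shows "(\<lambda>\<omega>. \<phi> (\<omega> n)) \<in> borel_measurable \<nu>"
  using integrable_ray by (rule borel_measurable_integrable)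

lemma integral_ray:
  fixes \<phi> :: "'a \<Rightarrow> 'c::{banach, second_countable_topology}"
  shows "(\<integral>\<omega>. \<phi> (\<omega> n) \<partial>\<nu>) = (\<Sum>x\<in>sphere b n. \<phi> x) /\<^sub>R scard n"
proof -
  have "(\<integral>\<omega>. \<phi> (\<omega> n) \<partial>\<nu>) = (\<integral>\<omega>. (\<Sum>x\<in>sphere b n. indicator (cylinder E b x) \<omega> *\<^sub>R \<phi> x) \<partial>\<nu>)"
    by (rule Bochner_Integration.integral_cong[OF refl ray_eval])
  also have "\<dots> = (\<Sum>x\<in>sphere b n. prob (cylinder E b x) *\<^sub>R \<phi> x)"
    by (subst Bochner_Integration.integral_sum, rule integrable_cylinder_indicator)
       (simp only: integral_cylinder_indicator)
  also have "\<dots> = (\<Sum>x\<in>sphere b n. (1 / scard n) *\<^sub>R \<phi> x)"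
    by (intro sum.cong refl) (auto simp: measure_cylinder sphere_def)
  finally show ?thesis by (simp add: scaleR_sum_right inverse_eq_divide)
qed

lemma prob_ray: "prob {\<omega>\<in>space \<nu>. P (\<omega> n)} = real (card {x\<in>sphere b n. P x}) / scard n"
proof -
  have m: "{\<omega>\<in>space \<nu>. P (\<omega> n)} \<in> sets \<nu>"
  proof -
    have "(\<lambda>\<omega>. of_bool (P (\<omega> n)) :: real) \<in> borel_measurable \<nu>" by (rule measurable_ray)
    then have "(\<lambda>\<omega>. of_bool (P (\<omega> n)) :: real) -` {1} \<inter> space \<nu> \<in> sets \<nu>" by (rule measurable_sets) simp
    then show ?thesis by (rule back_subst[where P = "\<lambda>A. A \<in> sets \<nu>"]) (auto split: if_splits)
  qed
  have "prob {\<omega>\<in>space \<nu>. P (\<omega> n)} = (\<integral>\<omega>. indicator {\<omega>\<in>space \<nu>. P (\<omega> n)} \<omega> \<partial>\<nu>)"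
    using m by simp
  also have "\<dots> = (\<integral>\<omega>. of_bool (P (\<omega> n)) \<partial>\<nu>)"
    by (rule Bochner_Integration.integral_cong) (auto simp: indicator_def)
  also have "\<dots> = (\<Sum>x\<in>sphere b n. of_bool (P x)) /\<^sub>R scard n" by (rule integral_ray)
  also have "(\<Sum>x\<in>sphere b n. of_bool (P x)) = real (card {x\<in>sphere b n. P x})"
    by (simp add: Int_def)
  finally show ?thesis by (simp add: divide_inverse)
qed

text \<open>Since \<open>\<nu>\<close> divides the mass of a cylinder equally among the children,
  this mean value property is the martingale property of \<open>\<Phi> (\<omega> n)\<close> for the
  filtration by the first \<open>n\<close> vertices, phrased without conditional
  expectations.\<close>

definition martingale :: "('a \<Rightarrow> complex) \<Rightarrow> bool" where
  "martingale \<Phi> \<longleftrightarrow> (\<forall>x. (\<Sum>y\<in>children b x. \<Phi> y) = of_nat (card (children b x)) * \<Phi> x)"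

lemma integrable_cylinder_mult:
  fixes F :: "(nat \<Rightarrow> 'a) \<Rightarrow> complex"
  shows "integrable \<nu> F \<Longrightarrow> integrable \<nu> (\<lambda>\<omega>. indicator (cylinder E b x) \<omega> * F \<omega>)"
  using integrable_mult_indicator[OF cylinder_sets, of F x] by (simp add: scaleR_conv_of_real of_real_indicator)

text \<open>The cylinder is split into those of the children. After the mean value property is
  applied, the number of children cancels against the growth of \<open>scard\<close>.\<close>

lemma integral_cylinder_ray:
  assumes "martingale \<Phi>"
  shows "(\<integral>\<omega>. indicator (cylinder E b x) \<omega> * \<Phi> (\<omega> (gd b x + k)) \<partial>\<nu>) = \<Phi> x / of_real (scard (gd b x))"
proof (induction k arbitrary: x)
  case 0
  have "(\<integral>\<omega>. indicator (cylinder E b x) \<omega> * \<Phi> (\<omega> (gd b x + 0)) \<partial>\<nu>) =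
        (\<integral>\<omega>. indicator (cylinder E b x) \<omega> *\<^sub>R \<Phi> x \<partial>\<nu>)"
    by (rule Bochner_Integration.integral_cong) (auto simp: indicator_def cylinder_iff)
  also have "\<dots> = prob (cylinder E b x) *\<^sub>R \<Phi> x"
    by (rule integral_cylinder_indicator)
  finally show ?case by (simp add: measure_cylinder scaleR_conv_of_real)
next
  case (Suc k)
  have "(\<integral>\<omega>. indicator (cylinder E b x) \<omega> * \<Phi> (\<omega> (gd b x + Suc k)) \<partial>\<nu>) =
        (\<integral>\<omega>. (\<Sum>y\<in>children b x. indicator (cylinder E b y) \<omega> * \<Phi> (\<omega> (gd b y + k))) \<partial>\<nu>)"
  proof (rule Bochner_Integration.integral_cong[OF refl])
    fix \<omega>
    have disj: "disjoint_family_on (cylinder E b) (children b x)"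
      unfolding disjoint_family_on_def using cylinder_disjoint by (auto simp: children_def)
    have "indicator (cylinder E b x) \<omega> = (\<Sum>y\<in>children b x. indicator (cylinder E b y) \<omega> :: complex)"
      unfolding cylinder_children[of b x]
      by (rule indicator_UN_disjoint[OF finite_children disj])
    then have "indicator (cylinder E b x) \<omega> * \<Phi> (\<omega> (gd b x + Suc k)) =
      (\<Sum>y\<in>children b x. indicator (cylinder E b y) \<omega> * \<Phi> (\<omega> (gd b x + Suc k)))"
      by (simp add: sum_distrib_right)
    also have "\<dots> = (\<Sum>y\<in>children b x. indicator (cylinder E b y) \<omega> * \<Phi> (\<omega> (gd b y + k)))"
      by (intro sum.cong refl) (simp add: children_def)
    finally show "indicator (cylinder E b x) \<omega> * \<Phi> (\<omega> (gd b x + Suc k)) = \<dots>" .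
  qed
  also have "\<dots> = (\<Sum>y\<in>children b x. \<Phi> y / of_real (scard (gd b y)))"
    by (subst Bochner_Integration.integral_sum) (auto intro!: integrable_cylinder_mult sum.cong simp: Suc.IH)
  also have "\<dots> = (\<Sum>y\<in>children b x. \<Phi> y / of_real (scard (Suc (gd b x))))"
    by (intro sum.cong refl) (simp add: children_def)
  also have "\<dots> = of_nat (card (children b x)) * \<Phi> x / of_real (scard (Suc (gd b x)))"
    using assms by (simp only: sum_divide_distrib[symmetric] martingale_def)
  also have "\<dots> = \<Phi> x / of_real (scard (gd b x))"
    using q unfolding scard_Suc by (simp add: card_children)
  finally show ?case .
qed

section \<open>Energy and convergence of boundary martingales\<close>

definition ray_energy :: "('a \<Rightarrow> complex) \<Rightarrow> nat \<Rightarrow> real" where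
  "ray_energy \<Phi> n = (\<integral>\<omega>. (cmod (\<Phi> (\<omega> n)))\<^sup>2 \<partial>\<nu>)"

text \<open>The cross term is evaluated with the \<open>n\<close>-th vertex frozen: on each cylinder
  of level \<open>n\<close> the later value integrates to the earlier one, so the mixed integral
  equals the energy at time \<open>n\<close>.\<close>

lemma martingale_orthogonality:
  assumes "martingale \<Phi>" "n \<le> m"
  shows "integrable \<nu> (\<lambda>\<omega>. (cmod (\<Phi> (\<omega> m) - \<Phi> (\<omega> n)))\<^sup>2)" (is ?I)
    and "(\<integral>\<omega>. (cmod (\<Phi> (\<omega> m) - \<Phi> (\<omega> n)))\<^sup>2 \<partial>\<nu>) = ray_energy \<Phi> m - ray_energy \<Phi> n" (is ?E)
proof -
  let ?S = "\<lambda>\<omega>. \<Sum>x\<in>sphere b n. cnj (\<Phi> x) * (indicator (cylinder E b x) \<omega> * \<Phi> (\<omega> m))"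
  have prod: "\<Phi> (\<omega> m) * cnj (\<Phi> (\<omega> n)) = ?S \<omega>" if "\<omega> \<in> space \<nu>" for \<omega>
    by (subst ray_eval[OF that, of "\<lambda>x. cnj (\<Phi> x)" n])
       (simp only: sum_distrib_left scaleR_conv_of_real of_real_indicator mult_ac)
  have intS: "integrable \<nu> ?S"
    by (intro Bochner_Integration.integrable_sum integrable_mult_right integrable_cylinder_mult integrable_ray)
  have int: "integrable \<nu> (\<lambda>\<omega>. \<Phi> (\<omega> m) * cnj (\<Phi> (\<omega> n)))"
    using intS by (subst Bochner_Integration.integrable_cong[OF refl prod])
  have "(\<integral>\<omega>. \<Phi> (\<omega> m) * cnj (\<Phi> (\<omega> n)) \<partial>\<nu>) = (\<integral>\<omega>. ?S \<omega> \<partial>\<nu>)"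
    by (rule Bochner_Integration.integral_cong[OF refl prod])
  also have "\<dots> = (\<Sum>x\<in>sphere b n. cnj (\<Phi> x) * (\<integral>\<omega>. indicator (cylinder E b x) \<omega> * \<Phi> (\<omega> m) \<partial>\<nu>))"
    by (subst Bochner_Integration.integral_sum)
       (auto intro!: integrable_mult_right integrable_cylinder_mult)
  also have "\<dots> = (\<Sum>x\<in>sphere b n. of_real ((cmod (\<Phi> x))\<^sup>2) /\<^sub>R scard n)"
  proof (intro sum.cong refl)
    fix x assume x: "x \<in> sphere b n"
    then have "(\<integral>\<omega>. indicator (cylinder E b x) \<omega> * \<Phi> (\<omega> m) \<partial>\<nu>) = \<Phi> x / of_real (scard n)"
      using integral_cylinder_ray[OF assms(1), of x "m - n"] assms(2) by (simp add: sphere_def)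
    then show "cnj (\<Phi> x) * (\<integral>\<omega>. indicator (cylinder E b x) \<omega> * \<Phi> (\<omega> m) \<partial>\<nu>) =
        of_real ((cmod (\<Phi> x))\<^sup>2) /\<^sub>R scard n"
      by (simp only: complex_norm_square) (simp add: scaleR_conv_of_real divide_inverse mult_ac)
  qed
  also have "\<dots> = of_real (ray_energy \<Phi> n)"
    unfolding ray_energy_def integral_ray[of "\<lambda>x. (cmod (\<Phi> x))\<^sup>2"]
    by (simp add: scaleR_conv_of_real sum_distrib_left)
  finally have cross: "(\<integral>\<omega>. \<Phi> (\<omega> m) * cnj (\<Phi> (\<omega> n)) \<partial>\<nu>) = of_real (ray_energy \<Phi> n)" .
  have expand: "(cmod (u - v))\<^sup>2 = (cmod u)\<^sup>2 + (cmod v)\<^sup>2 - 2 * Re (u * cnj v)" for u v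
    unfolding cmod_power2 by (simp add: power2_eq_square algebra_simps)
  have intRe: "integrable \<nu> (\<lambda>\<omega>. 2 * Re (\<Phi> (\<omega> m) * cnj (\<Phi> (\<omega> n))))"
    using int by (intro integrable_mult_right integrable_Re)
  have sq: "integrable \<nu> (\<lambda>\<omega>. (cmod (\<Phi> (\<omega> k)))\<^sup>2)" for k by (rule integrable_ray)
  show ?I unfolding expand
    by (intro Bochner_Integration.integrable_diff Bochner_Integration.integrable_add sq intRe)
  have "(\<integral>\<omega>. 2 * Re (\<Phi> (\<omega> m) * cnj (\<Phi> (\<omega> n))) \<partial>\<nu>) = 2 * ray_energy \<Phi> n"
    using int cross by (subst Bochner_Integration.integral_mult_right_zero) (simp only: integral_Re Re_complex_of_real)
  then show ?E
    unfolding expand Bochner_Integration.integral_diff[OF Bochner_Integration.integrable_add[OF sq[of m] sq[of n]] intRe]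
      Bochner_Integration.integral_add[OF sq[of m] sq[of n]]
    by (simp add: ray_energy_def)
qed

text \<open>This is the nonnegativity of the variance of \<open>cmod (G \<omega>)\<close>.\<close>

lemma L1_le_L2:
  assumes "integrable \<nu> (\<lambda>\<omega>. cmod (G \<omega>))" "integrable \<nu> (\<lambda>\<omega>. (cmod (G \<omega>))\<^sup>2)"
  shows "(\<integral>\<omega>. cmod (G \<omega>) \<partial>\<nu>) \<le> sqrt (\<integral>\<omega>. (cmod (G \<omega>))\<^sup>2 \<partial>\<nu>)"
proof -
  have "0 \<le> variance (\<lambda>\<omega>. cmod (G \<omega>))" by (rule variance_positive)
  then show ?thesis using variance_eq[OF assms] by (intro real_le_rsqrt) simp
qed

text \<open>By orthogonality the energies increase; being bounded they are Cauchy, so by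
  \<open>L1_le_L2\<close> the martingale is Cauchy in the mean. A subsequence converging almost
  everywhere defines \<open>F\<close>, and Fatou's lemma gives convergence in the mean of the whole
  sequence.\<close>

lemma L2_bounded_martingale_limit:
  assumes mart: "martingale \<Phi>" and bd: "\<And>n. ray_energy \<Phi> n \<le> C"
  obtains F where "integrable \<nu> F"
    "(\<lambda>n. \<integral>\<omega>. cmod (F \<omega> - \<Phi> (\<omega> n)) \<partial>\<nu>) \<longlonglongrightarrow> 0"
proof -
  let ?u = "ray_energy \<Phi>"
  have mono: "?u n \<le> ?u m" if "n \<le> m" for n m
  proof -
    have "0 \<le> (\<integral>\<omega>. (cmod (\<Phi> (\<omega> m) - \<Phi> (\<omega> n)))\<^sup>2 \<partial>\<nu>)" by (rule Bochner_Integration.integral_nonneg) simp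
    then show ?thesis using martingale_orthogonality(2)[OF mart that] by simp
  qed
  have "Bseq ?u"
  proof (rule BseqI')
    fix n
    have "0 \<le> ?u n" unfolding ray_energy_def by (rule Bochner_Integration.integral_nonneg) simp
    then show "norm (?u n) \<le> C" using bd[of n] by simp
  qed
  then have "convergent ?u"
    using mono by (intro Bseq_mono_convergent) auto
  then have "Cauchy ?u" by (simp add: Cauchy_convergent_iff)
  have diff: "(\<integral>\<omega>. cmod (\<Phi> (\<omega> m) - \<Phi> (\<omega> n)) \<partial>\<nu>) \<le> sqrt (?u m - ?u n)" if "n \<le> m" for n m
  proof -
    have "integrable \<nu> (\<lambda>\<omega>. cmod (\<Phi> (\<omega> m) - \<Phi> (\<omega> n)))" by simp
    from L1_le_L2[OF this martingale_orthogonality(1)[OF mart that]]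
    show ?thesis using martingale_orthogonality(2)[OF mart that] by simp
  qed
  have tail: "\<exists>N. \<forall>m\<ge>N. \<forall>n\<ge>N. (\<integral>\<omega>. cmod (\<Phi> (\<omega> m) - \<Phi> (\<omega> n)) \<partial>\<nu>) < e" if e: "e > 0" for e
  proof -
    obtain N where N: "\<And>m n. m \<ge> N \<Longrightarrow> n \<ge> N \<Longrightarrow> \<bar>?u m - ?u n\<bar> < e\<^sup>2"
      using \<open>Cauchy ?u\<close> e unfolding Cauchy_iff real_norm_def by (meson zero_less_power)
    have 1: "(\<integral>\<omega>. cmod (\<Phi> (\<omega> m) - \<Phi> (\<omega> n)) \<partial>\<nu>) < e" if "n \<ge> N" "n \<le> m" for n m
    proof -
      have "?u m - ?u n < e\<^sup>2" using N[of m n] that by auto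
      then have "sqrt (?u m - ?u n) < sqrt (e\<^sup>2)" by (rule real_sqrt_less_mono)
      then show ?thesis using diff[OF that(2)] e by simp
    qed
    have "(\<integral>\<omega>. cmod (\<Phi> (\<omega> m) - \<Phi> (\<omega> n)) \<partial>\<nu>) < e" if "m \<ge> N" "n \<ge> N" for m n
      using 1[of n m] 1[of m n] that by (cases "n \<le> m") (auto simp: norm_minus_commute)
    then show ?thesis by blast
  qed
  obtain r where r: "strict_mono r" and ae: "AE \<omega> in \<nu>. Cauchy (\<lambda>i. \<Phi> (\<omega> (r i)))"
    using cauchy_L1_AE_cauchy_subseq[of \<nu> "\<lambda>n \<omega>. \<Phi> (\<omega> n)", OF integrable_ray tail] by blast
  define F where "F \<omega> = lim (\<lambda>i. \<Phi> (\<omega> (r i)))" for \<omega>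
  have [measurable]: "F \<in> borel_measurable \<nu>"
    unfolding F_def by (rule borel_measurable_lim_metric) (rule measurable_ray)
  have lim: "AE \<omega> in \<nu>. (\<lambda>i. \<Phi> (\<omega> (r i))) \<longlonglongrightarrow> F \<omega>"
    using ae by eventually_elim (simp add: F_def Cauchy_convergent_iff convergent_LIMSEQ_iff)
  have nn: "\<exists>N. \<forall>n\<ge>N. (\<integral>\<^sup>+\<omega>. ennreal (cmod (F \<omega> - \<Phi> (\<omega> n))) \<partial>\<nu>) \<le> ennreal e" if e: "e > 0" for e
  proof -
    obtain N where N: "\<And>m n. m \<ge> N \<Longrightarrow> n \<ge> N \<Longrightarrow> (\<integral>\<omega>. cmod (\<Phi> (\<omega> m) - \<Phi> (\<omega> n)) \<partial>\<nu>) < e"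
      using tail[OF e] by blast
    have "(\<integral>\<^sup>+\<omega>. ennreal (cmod (F \<omega> - \<Phi> (\<omega> n))) \<partial>\<nu>) \<le> ennreal e" if n: "n \<ge> N" for n
    proof -
      have "(\<integral>\<^sup>+\<omega>. ennreal (cmod (F \<omega> - \<Phi> (\<omega> n))) \<partial>\<nu>) =
          (\<integral>\<^sup>+\<omega>. liminf (\<lambda>i. ennreal (cmod (\<Phi> (\<omega> (r i)) - \<Phi> (\<omega> n)))) \<partial>\<nu>)"
      proof (rule nn_integral_cong_AE)
        show "AE \<omega> in \<nu>. ennreal (cmod (F \<omega> - \<Phi> (\<omega> n))) = liminf (\<lambda>i. ennreal (cmod (\<Phi> (\<omega> (r i)) - \<Phi> (\<omega> n))))"
          using lim
        proof eventually_elim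
          case (elim \<omega>)
          then have "(\<lambda>i. ennreal (cmod (\<Phi> (\<omega> (r i)) - \<Phi> (\<omega> n)))) \<longlonglongrightarrow> ennreal (cmod (F \<omega> - \<Phi> (\<omega> n)))"
            by (intro tendsto_intros)
          from lim_imp_Liminf[OF _ this] show ?case by simp
        qed
      qed
      also have "\<dots> \<le> liminf (\<lambda>i. \<integral>\<^sup>+\<omega>. ennreal (cmod (\<Phi> (\<omega> (r i)) - \<Phi> (\<omega> n))) \<partial>\<nu>)"
        by (intro nn_integral_liminf) measurable
      also have "\<dots> \<le> liminf (\<lambda>i. ennreal e)"
      proof (rule Liminf_mono)
        show "\<forall>\<^sub>F i in sequentially. (\<integral>\<^sup>+\<omega>. ennreal (cmod (\<Phi> (\<omega> (r i)) - \<Phi> (\<omega> n))) \<partial>\<nu>) \<le> ennreal e"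
          using eventually_ge_at_top[of N]
        proof eventually_elim
          case (elim i)
          then have "r i \<ge> N" using seq_suble[OF r, of i] by simp
          then have "(\<integral>\<omega>. cmod (\<Phi> (\<omega> (r i)) - \<Phi> (\<omega> n)) \<partial>\<nu>) \<le> e" using N[of "r i" n] n by simp
          then show ?case by (subst nn_integral_eq_integral) (auto intro: ennreal_leI)
        qed
      qed
      also have "\<dots> = ennreal e" by (simp add: Liminf_const)
      finally show ?thesis .
    qed
    then show ?thesis by blast
  qed
  obtain N where "(\<integral>\<^sup>+\<omega>. ennreal (cmod (F \<omega> - \<Phi> (\<omega> N))) \<partial>\<nu>) \<le> ennreal 1"
    using nn[of 1] by auto
  then have "integrable \<nu> (\<lambda>\<omega>. F \<omega> - \<Phi> (\<omega> N))"
    by (intro integrableI_bounded) (auto intro: order_le_less_trans)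
  then have "integrable \<nu> (\<lambda>\<omega>. (F \<omega> - \<Phi> (\<omega> N)) + \<Phi> (\<omega> N))"
    by (rule Bochner_Integration.integrable_add) simp
  then have intF: "integrable \<nu> F" by simp
  have "(\<lambda>n. \<integral>\<omega>. cmod (F \<omega> - \<Phi> (\<omega> n)) \<partial>\<nu>) \<longlonglongrightarrow> 0"
  proof (rule LIMSEQ_I)
    fix e :: real assume e: "e > 0"
    obtain N where N: "\<And>n. n \<ge> N \<Longrightarrow> (\<integral>\<^sup>+\<omega>. ennreal (cmod (F \<omega> - \<Phi> (\<omega> n))) \<partial>\<nu>) \<le> ennreal (e / 2)"
      using nn[of "e / 2"] e by auto
    have "(\<integral>\<omega>. cmod (F \<omega> - \<Phi> (\<omega> n)) \<partial>\<nu>) < e" if "n \<ge> N" for n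
    proof -
      have "integrable \<nu> (\<lambda>\<omega>. cmod (F \<omega> - \<Phi> (\<omega> n)))" using intF by simp
      then have "ennreal (\<integral>\<omega>. cmod (F \<omega> - \<Phi> (\<omega> n)) \<partial>\<nu>) \<le> ennreal (e / 2)"
        using N[OF that] by (subst (asm) nn_integral_eq_integral) auto
      then show ?thesis using e by (simp add: ennreal_le_iff)
    qed
    moreover have "0 \<le> (\<integral>\<omega>. cmod (F \<omega> - \<Phi> (\<omega> n)) \<partial>\<nu>)" for n by (rule Bochner_Integration.integral_nonneg) simp
    ultimately show "\<exists>N. \<forall>n\<ge>N. norm ((\<integral>\<omega>. cmod (F \<omega> - \<Phi> (\<omega> n)) \<partial>\<nu>) - 0) < e"
      by (intro exI[of _ N]) auto
  qed
  with intF show ?thesis by (rule that)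
qed

text \<open>From time \<open>gd b x\<close> on, the integral over the cylinder is constant along the
  martingale, so convergence in the mean hands it to the limit. Thus \<open>\<Phi> x\<close> is the
  mean of \<open>F\<close> over the cylinder of \<open>x\<close>.\<close>

lemma integral_cylinder_limit:
  assumes mart: "martingale \<Phi>" and F: "integrable \<nu> F"
    and lim: "(\<lambda>n. \<integral>\<omega>. cmod (F \<omega> - \<Phi> (\<omega> n)) \<partial>\<nu>) \<longlonglongrightarrow> 0"
  shows "(\<integral>\<omega>. indicator (cylinder E b x) \<omega> * F \<omega> \<partial>\<nu>) = \<Phi> x / of_real (scard (gd b x))"
proof -
  let ?I = "\<integral>\<omega>. indicator (cylinder E b x) \<omega> * F \<omega> \<partial>\<nu>" and ?c = "\<Phi> x / of_real (scard (gd b x))"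
  have "cmod (?I - ?c) \<le> (\<integral>\<omega>. cmod (F \<omega> - \<Phi> (\<omega> (gd b x + k))) \<partial>\<nu>)" for k
  proof -
    let ?\<Phi> = "\<lambda>\<omega>. \<Phi> (\<omega> (gd b x + k))"
    have int: "integrable \<nu> (\<lambda>\<omega>. indicator (cylinder E b x) \<omega> * F \<omega>)"
      "integrable \<nu> (\<lambda>\<omega>. indicator (cylinder E b x) \<omega> * ?\<Phi> \<omega>)"
      by (rule integrable_cylinder_mult[OF F], rule integrable_cylinder_mult[OF integrable_ray])
    have "?I - ?c = (\<integral>\<omega>. indicator (cylinder E b x) \<omega> * F \<omega> - indicator (cylinder E b x) \<omega> * ?\<Phi> \<omega> \<partial>\<nu>)"
      unfolding Bochner_Integration.integral_diff[OF int] integral_cylinder_ray[OF mart] ..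
    then have "cmod (?I - ?c) \<le> (\<integral>\<omega>. cmod (indicator (cylinder E b x) \<omega> * F \<omega> - indicator (cylinder E b x) \<omega> * ?\<Phi> \<omega>) \<partial>\<nu>)"
      by (simp only: integral_norm_bound)
    also have "\<dots> \<le> (\<integral>\<omega>. cmod (F \<omega> - ?\<Phi> \<omega>) \<partial>\<nu>)"
      by (intro integral_mono integrable_norm Bochner_Integration.integrable_diff int F integrable_ray)
        (auto simp: indicator_def)
    finally show ?thesis .
  qed
  moreover have "(\<lambda>k. \<integral>\<omega>. cmod (F \<omega> - \<Phi> (\<omega> (gd b x + k))) \<partial>\<nu>) \<longlonglongrightarrow> 0"
    using LIMSEQ_ignore_initial_segment[OF lim, of "gd b x"] by (simp add: add.commute)
  ultimately have "cmod (?I - ?c) \<le> 0" by (intro LIMSEQ_le_const) auto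
  then show ?thesis by simp
qed

text \<open>Where the modulus of \<open>F\<close> exceeds \<open>2 * \<alpha> ^ j\<close>, either
  the martingale exceeds \<open>\<alpha> ^ j\<close> or it is at least that far from
  \<open>F\<close>; Markov's inequality controls the second event. The time \<open>N + j\<close>
  depends on the layer because the available bound couples level and radius. As \<open>J\<close> is
  fixed, letting \<open>N\<close> tend to infinity removes the finitely many error terms.\<close>

lemma prob_limit_le:
  assumes F: "integrable \<nu> F"
    and lim: "(\<lambda>n. \<integral>\<omega>. cmod (F \<omega> - \<Phi> (\<omega> n)) \<partial>\<nu>) \<longlonglongrightarrow> 0"
    and \<alpha>: "\<alpha> > 0" and c: "\<And>j. c j \<ge> 0"
    and bd: "\<And>N. (\<Sum>j<J. c j * prob {\<omega>\<in>space \<nu>. cmod (\<Phi> (\<omega> (N + j))) > \<alpha> ^ j}) \<le> K"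
  shows "(\<Sum>j<J. c j * prob {\<omega>\<in>space \<nu>. cmod (F \<omega>) > 2 * \<alpha> ^ j}) \<le> K"
proof -
  have [measurable]: "F \<in> borel_measurable \<nu>" using F by simp
  let ?d = "\<lambda>n. \<integral>\<omega>. cmod (F \<omega> - \<Phi> (\<omega> n)) \<partial>\<nu>"
  have split: "prob {\<omega>\<in>space \<nu>. cmod (F \<omega>) > 2 * \<alpha> ^ j} \<le>
      prob {\<omega>\<in>space \<nu>. cmod (\<Phi> (\<omega> n)) > \<alpha> ^ j} + ?d n / \<alpha> ^ j" for j n
  proof -
    let ?A = "{\<omega>\<in>space \<nu>. cmod (\<Phi> (\<omega> n)) > \<alpha> ^ j}" and ?B = "{\<omega>\<in>space \<nu>. cmod (F \<omega> - \<Phi> (\<omega> n)) \<ge> \<alpha> ^ j}"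
    have [measurable]: "(\<lambda>\<omega>. \<Phi> (\<omega> n)) \<in> borel_measurable \<nu>" by (rule measurable_ray)
    have AB: "?A \<in> sets \<nu>" "?B \<in> sets \<nu>" by measurable
    have "{\<omega>\<in>space \<nu>. cmod (F \<omega>) > 2 * \<alpha> ^ j} \<subseteq> ?A \<union> ?B"
    proof (intro subsetI)
      fix \<omega> assume "\<omega> \<in> {\<omega>\<in>space \<nu>. cmod (F \<omega>) > 2 * \<alpha> ^ j}"
      moreover have "cmod (F \<omega>) \<le> cmod (F \<omega> - \<Phi> (\<omega> n)) + cmod (\<Phi> (\<omega> n))"
        using norm_triangle_ineq[of "F \<omega> - \<Phi> (\<omega> n)" "\<Phi> (\<omega> n)"] by simp
      ultimately show "\<omega> \<in> ?A \<union> ?B" by auto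
    qed
    then have "prob {\<omega>\<in>space \<nu>. cmod (F \<omega>) > 2 * \<alpha> ^ j} \<le> prob (?A \<union> ?B)"
      using AB by (intro finite_measure_mono) auto
    also have "\<dots> \<le> prob ?A + prob ?B"
      using AB by (rule measure_Un_le)
    also have "prob ?B \<le> ?d n / \<alpha> ^ j"
      using F \<alpha> by (intro integral_Markov_inequality_measure[where A = "space \<nu>"] integrable_norm
          Bochner_Integration.integrable_diff integrable_ray) auto
    finally show ?thesis by simp
  qed
  have "(\<Sum>j<J. c j * prob {\<omega>\<in>space \<nu>. cmod (F \<omega>) > 2 * \<alpha> ^ j}) \<le>
      K + (\<Sum>j<J. c j * (?d (N + j) / \<alpha> ^ j))" for N
  proof -
    have "(\<Sum>j<J. c j * prob {\<omega>\<in>space \<nu>. cmod (F \<omega>) > 2 * \<alpha> ^ j}) \<le>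
      (\<Sum>j<J. c j * prob {\<omega>\<in>space \<nu>. cmod (\<Phi> (\<omega> (N + j))) > \<alpha> ^ j} + c j * (?d (N + j) / \<alpha> ^ j))"
      unfolding distrib_left[symmetric] using c split by (intro sum_mono mult_left_mono) auto
    then show ?thesis using bd[of N] by (simp add: sum.distrib)
  qed
  moreover have "(\<lambda>N. K + (\<Sum>j<J. c j * (?d (N + j) / \<alpha> ^ j))) \<longlonglongrightarrow> K + (\<Sum>j<J. c j * (0 / \<alpha> ^ j))"
    using \<alpha> by (intro tendsto_intros LIMSEQ_ignore_initial_segment[OF lim]) auto
  ultimately show ?thesis by (intro LIMSEQ_le_const[of _ K]) auto
qed

text \<open>The levels are chosen so that they are exceeded exactly when the \<open>r\<close>-th
  power \<open>Y\<close> of half the modulus exceeds \<open>q ^ j\<close>. Then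
  \<open>layer_bound\<close> with base \<open>q\<close> bounds the integral of \<open>Y\<close>
  truncated at \<open>q ^ J\<close>, uniformly in \<open>J\<close>, and Fatou's lemma removes the
  truncation.\<close>

lemma in_Lp_if_layers_bounded:
  assumes [measurable]: "F \<in> borel_measurable \<nu>" and r: "r > 0"
    and bd: "\<And>J. (\<Sum>j<J. real q ^ j * prob {\<omega>\<in>space \<nu>. cmod (F \<omega>) > 2 * (real q powr (1 / r)) ^ j}) \<le> K"
  shows "in_Lp \<nu> r F"
proof -
  define Y where "Y \<omega> = (cmod (F \<omega>) / 2) powr r" for \<omega>
  have [measurable]: "Y \<in> borel_measurable \<nu>" unfolding Y_def by measurable
  have Y0: "Y \<omega> \<ge> 0" for \<omega> by (simp add: Y_def)
  have q1: "real q > 1" using q by simp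
  have lvl: "Y \<omega> > real q ^ j \<longleftrightarrow> cmod (F \<omega>) > 2 * (real q powr (1 / r)) ^ j" for \<omega> j
  proof -
    have "real q ^ j = ((real q powr (1 / r)) ^ j) powr r"
      using q1 r by (simp add: powr_realpow[symmetric] powr_powr)
    then have "Y \<omega> > real q ^ j \<longleftrightarrow> ((real q powr (1 / r)) ^ j) powr r < (cmod (F \<omega>) / 2) powr r"
      by (simp add: Y_def)
    also have "\<dots> \<longleftrightarrow> (real q powr (1 / r)) ^ j < cmod (F \<omega>) / 2"
    proof
      assume "(real q powr (1 / r)) ^ j < cmod (F \<omega>) / 2"
      then show "((real q powr (1 / r)) ^ j) powr r < (cmod (F \<omega>) / 2) powr r"
        using r by (intro powr_less_mono2) auto
    next
      assume less: "((real q powr (1 / r)) ^ j) powr r < (cmod (F \<omega>) / 2) powr r"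
      show "(real q powr (1 / r)) ^ j < cmod (F \<omega>) / 2"
      proof (rule ccontr)
        assume "\<not> (real q powr (1 / r)) ^ j < cmod (F \<omega>) / 2"
        then have "(cmod (F \<omega>) / 2) powr r \<le> ((real q powr (1 / r)) ^ j) powr r"
          using r by (intro powr_mono2) auto
        then show False using less by simp
      qed
    qed
    finally show ?thesis by (simp add: field_simps)
  qed
  have trunc: "(\<integral>\<^sup>+\<omega>. ennreal (min (Y \<omega>) (real q ^ J)) \<partial>\<nu>) \<le> ennreal (1 + real q * K)" for J
  proof -
    let ?A = "\<lambda>j. {\<omega>\<in>space \<nu>. Y \<omega> > real q ^ j}"
    let ?G = "\<lambda>\<omega>. 1 + (\<Sum>j<J. real q ^ (j + 1) * indicator (?A j) \<omega>)"
    have A: "?A j \<in> sets \<nu>" for j by measurable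
    have intA: "integrable \<nu> (\<lambda>\<omega>. real q ^ (j + 1) * indicator (?A j) \<omega>)" for j
      using A[of j] by (intro integrable_mult_right integrable_real_indicator) (auto simp: emeasure_finite less_top[symmetric])
    have "(\<integral>\<^sup>+\<omega>. ennreal (min (Y \<omega>) (real q ^ J)) \<partial>\<nu>) \<le> (\<integral>\<^sup>+\<omega>. ennreal (?G \<omega>) \<partial>\<nu>)"
    proof (intro nn_integral_mono ennreal_leI)
      fix \<omega> assume "\<omega> \<in> space \<nu>"
      then have "indicator (?A j) \<omega> = (of_bool (min (Y \<omega>) (real q ^ J) > real q ^ j) :: real)" if "j < J" for j
        using that q1 by (auto simp: indicator_def)
      then have "(\<Sum>j<J. real q ^ (j + 1) * indicator (?A j) \<omega>) =
          (\<Sum>j<J. real q ^ (j + 1) * of_bool (min (Y \<omega>) (real q ^ J) > real q ^ j))"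
        by (intro sum.cong refl) simp
      then show "min (Y \<omega>) (real q ^ J) \<le> ?G \<omega>"
        using layer_bound[OF q1, of "min (Y \<omega>) (real q ^ J)" J] by simp
    qed
    also have "\<dots> = ennreal (\<integral>\<omega>. ?G \<omega> \<partial>\<nu>)"
      by (intro nn_integral_eq_integral Bochner_Integration.integrable_add Bochner_Integration.integrable_sum intA)
         (auto intro!: add_nonneg_nonneg sum_nonneg)
    also have "(\<integral>\<omega>. ?G \<omega> \<partial>\<nu>) = 1 + (\<Sum>j<J. real q ^ (j + 1) * prob (?A j))"
    proof -
      have one: "integrable \<nu> (\<lambda>_. 1 :: real)" by simp
      show ?thesis
        unfolding Bochner_Integration.integral_add[OF one Bochner_Integration.integrable_sum[OF intA]]
          Bochner_Integration.integral_sum[OF intA]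
        using A prob_space by simp
    qed
    also have "\<dots> = 1 + real q * (\<Sum>j<J. real q ^ j * prob (?A j))"
      by (simp add: sum_distrib_left mult_ac)
    also have "\<dots> \<le> 1 + real q * K"
      using bd[of J] q1 unfolding lvl by simp
    finally show ?thesis by (simp add: ennreal_leI)
  qed
  have "(\<integral>\<^sup>+\<omega>. ennreal (Y \<omega>) \<partial>\<nu>) = (\<integral>\<^sup>+\<omega>. liminf (\<lambda>J. ennreal (min (Y \<omega>) (real q ^ J))) \<partial>\<nu>)"
  proof (rule nn_integral_cong)
    fix \<omega>
    obtain J0 where J0: "Y \<omega> < real q ^ J0" using real_arch_pow[OF q1] by blast
    have "\<forall>\<^sub>F J in sequentially. ennreal (min (Y \<omega>) (real q ^ J)) = ennreal (Y \<omega>)"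
      using eventually_ge_at_top[of J0]
    proof eventually_elim
      case (elim J)
      then have "real q ^ J0 \<le> real q ^ J" using q1 by (intro power_increasing) auto
      then show ?case using J0 by (simp add: min_def)
    qed
    then have "(\<lambda>J. ennreal (min (Y \<omega>) (real q ^ J))) \<longlonglongrightarrow> ennreal (Y \<omega>)" by (rule tendsto_eventually)
    from lim_imp_Liminf[OF _ this] show "ennreal (Y \<omega>) = liminf (\<lambda>J. ennreal (min (Y \<omega>) (real q ^ J)))"
      by simp
  qed
  also have "\<dots> \<le> liminf (\<lambda>J. \<integral>\<^sup>+\<omega>. ennreal (min (Y \<omega>) (real q ^ J)) \<partial>\<nu>)"
    by (intro nn_integral_liminf) measurable
  also have "\<dots> \<le> liminf (\<lambda>J. ennreal (1 + real q * K))"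
    by (intro Liminf_mono always_eventually allI trunc)
  also have "\<dots> = ennreal (1 + real q * K)" by (simp add: Liminf_const)
  also have "\<dots> < \<infinity>" by simp
  finally have "integrable \<nu> Y"
    using Y0 by (intro integrableI_nonneg) auto
  then have "integrable \<nu> (\<lambda>\<omega>. 2 powr r * Y \<omega>)" by (rule integrable_mult_right)
  moreover have "2 powr r * Y \<omega> = cmod (F \<omega>) powr r" for \<omega>
    by (simp add: Y_def powr_mult[symmetric])
  ultimately show ?thesis by (simp add: in_Lp_def)
qed

section \<open>The boundary function of an eigenfunction\<close>

lemma weak_type_radial_derivative:
  assumes f: "weak_type r K f" and K: "K \<ge> 0" and B: "cmod B \<ge> 1"
  shows "weak_type r (K * (real q + 2) * 2 powr r) (\<lambda>x. if x = b then f x else f x - f (par b x) / B)"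
  unfolding weak_type_def
proof (intro allI impI)
  fix t :: real assume t: "t > 0"
  let ?m = "\<lambda>x. if x = b then f x else f x - f (par b x) / B"
  let ?S = "{x. cmod (f x) > t / 2}"
  have S: "finite ?S" "real (card ?S) \<le> K * (t / 2) powr (- r)"
    using f t unfolding weak_type_def by (meson half_gt_zero)+
  \<comment> \<open>A large radial difference forces \<open>f\<close> to be large at
    \<open>x\<close> or at its parent. A vertex is the parent of at most \<open>q + 1\<close>
    others, which accounts for the factor \<open>q + 2\<close>.\<close>
  have sub: "{x. cmod (?m x) > t} \<subseteq> ?S \<union> (\<Union>z\<in>?S. children b z)"
  proof
    fix x assume x: "x \<in> {x. cmod (?m x) > t}"
    show "x \<in> ?S \<union> (\<Union>z\<in>?S. children b z)"
    proof (cases "x = b")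
      case True
      then show ?thesis using x t by simp
    next
      case False
      have "cmod (f x - f (par b x) / B) \<le> cmod (f x) + cmod (f (par b x) / B)"
        by (rule norm_triangle_ineq4)
      also have "cmod (f (par b x) / B) \<le> cmod (f (par b x))"
        using B by (simp add: norm_divide divide_le_eq mult_right_le_one_le) (metis mult.right_neutral mult_left_mono norm_ge_zero)
      finally have "cmod (f x) > t / 2 \<or> cmod (f (par b x)) > t / 2" using x False by auto
      moreover have "x \<in> children b (par b x)" using False by (simp add: children_iff)
      ultimately show ?thesis by blast
    qed
  qed
  have fin: "finite (?S \<union> (\<Union>z\<in>?S. children b z))" using S by simp
  have "card {x. cmod (?m x) > t} \<le> card (?S \<union> (\<Union>z\<in>?S. children b z))"
    using sub fin by (rule card_mono[rotated])
  also have "\<dots> \<le> card ?S + card (\<Union>z\<in>?S. children b z)" by (rule card_Un_le)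
  also have "card (\<Union>z\<in>?S. children b z) \<le> (\<Sum>z\<in>?S. card (children b z))" by (rule card_UN_le[OF S(1)])
  also have "(\<Sum>z\<in>?S. card (children b z)) \<le> (\<Sum>z\<in>?S. q + 1)" by (intro sum_mono) (simp add: card_children)
  finally have le: "card {x. cmod (?m x) > t} \<le> card ?S + (\<Sum>z\<in>?S. q + 1)" by simp
  have "card ?S + (\<Sum>z\<in>?S. q + 1) = (q + 2) * card ?S"
    by (simp only: sum_constant) (simp add: algebra_simps)
  with le have "card {x. cmod (?m x) > t} \<le> (q + 2) * card ?S" by (simp only:)
  then have "real (card {x. cmod (?m x) > t}) \<le> real ((q + 2) * card ?S)" unfolding of_nat_le_iff .
  also have "\<dots> = (real q + 2) * real (card ?S)" by (simp only: of_nat_mult of_nat_add of_nat_numeral)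
  also have "\<dots> \<le> (real q + 2) * (K * (t / 2) powr (- r))" using S by (intro mult_left_mono) auto
  also have "\<dots> = K * (real q + 2) * 2 powr r * t powr (- r)"
    using t by (simp add: powr_divide powr_minus_divide)
  finally show "finite {x. cmod (?m x) > t} \<and> real (card {x. cmod (?m x) > t}) \<le> K * (real q + 2) * 2 powr r * t powr (- r)"
    using finite_subset[OF sub fin] by blast
qed

text \<open>This solves the integrated form of \<open>kernel_power_step\<close> for the integral of
  \<open>F\<close> over the cylinder of \<open>x\<close> and divides by the measure of the cylinder:
  it is the mean that \<open>F\<close> must have there if \<open>f\<close> is its Poisson
  transform.\<close>

definition boundary_density :: "complex \<Rightarrow> ('a \<Rightarrow> complex) \<Rightarrow> 'a \<Rightarrow> complex" where
  "boundary_density B f x = (if x = b then f b else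
     of_real (scard (gd b x)) * ((f x - f (par b x) / B) * B\<^sup>2 / ((B\<^sup>2 - 1) * B ^ gd b x)))"

text \<open>Away from the root the eigenvalue equation makes the sum of \<open>f y - f x / B\<close>
  over the children equal to \<open>B * (f x - f (par b x) / B)\<close>, and the factor
  \<open>B\<close> cancels against the higher power of \<open>B\<close> in the denominator. At the
  root there is no parent, and the sum is \<open>(B\<^sup>2 - 1) / B * f b\<close>, which matches
  the separate value of the density at \<open>b\<close>.\<close>

lemma martingale_boundary_density:
  assumes eig: "\<And>x. of_nat (q + 1) * avg f x = (B + of_nat q / B) * f x" and B: "cmod B > 1"
  shows "martingale (boundary_density B f)"
  unfolding martingale_def
proof
  fix x
  have B0: "B \<noteq> 0" "B\<^sup>2 - 1 \<noteq> 0"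
  proof -
    show "B \<noteq> 0" using B by auto
    have "cmod (B\<^sup>2) > 1" using B by (simp add: norm_power one_less_power)
    then show "B\<^sup>2 - 1 \<noteq> 0" by auto
  qed
  have nbrs: "(\<Sum>y\<in>{y. E x y}. f y) = (B + of_nat q / B) * f x"
  proof -
    have "(of_nat (q + 1) :: complex) \<noteq> 0" unfolding of_nat_eq_0_iff by simp
    then have "(\<Sum>y\<in>{y. E x y}. f y) = of_nat (q + 1) * avg f x" unfolding avg_def by (metis nonzero_mult_div_cancel_left times_divide_eq_right)
    then show ?thesis using eig by simp
  qed
  let ?n = "gd b x" and ?k = "of_nat (card (children b x)) :: complex"
  let ?c = "of_real (scard (Suc ?n)) * (B\<^sup>2 / ((B\<^sup>2 - 1) * B ^ Suc ?n))"
  have "(\<Sum>y\<in>children b x. boundary_density B f y) = (\<Sum>y\<in>children b x. ?c * (f y - f x / B))"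
  proof (intro sum.cong refl)
    fix y assume y: "y \<in> children b x"
    then have "y \<noteq> b" "par b y = x" "gd b y = Suc ?n" by (simp add: children_iff, simp add: children_iff, simp add: children_def)
    then show "boundary_density B f y = ?c * (f y - f x / B)" by (simp add: boundary_density_def)
  qed
  also have "\<dots> = ?c * ((\<Sum>y\<in>children b x. f y) - ?k * f x / B)"
    by (simp only: sum_distrib_left[symmetric] sum_subtractf sum_constant times_divide_eq_right)
  also have "\<dots> = ?k * boundary_density B f x"
  proof (cases "x = b")
    case True
    have "(\<Sum>y\<in>children b b. f y) = (B + of_nat q / B) * f b" using nbrs True nbrs_root by simp
    then have "(\<Sum>y\<in>children b b. f y) - of_nat (q + 1) * f b / B = (B\<^sup>2 - 1) / B * f b"
      using B0(1) by (simp add: field_simps power2_eq_square)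
    moreover have "scard (Suc 0) = real (q + 1)" by (simp add: card_sphere)
    ultimately show ?thesis
      using True B0 by (simp add: boundary_density_def card_children power2_eq_square del: of_nat_add of_nat_Suc)
  next
    case False
    have "(\<Sum>y\<in>children b x. f y) = (B + of_nat q / B) * f x - f (par b x)"
      using nbrs sum_nbrs[OF False, of f] by (simp add: algebra_simps)
    then have "(\<Sum>y\<in>children b x. f y) - of_nat q * f x / B = B * (f x - f (par b x) / B)"
      using B0(1) by (simp add: field_simps)
    then show ?thesis
      using False B0 unfolding scard_Suc by (simp add: boundary_density_def card_children)
  qed
  finally show "(\<Sum>y\<in>children b x. boundary_density B f y) = ?k * boundary_density B f x" .
qed

text \<open>The sphere size, at most \<open>2 * q ^ n\<close>, divided by the modulus
  \<open>\<beta> ^ n\<close> of the power of \<open>B\<close> leaves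
  \<open>2 * \<alpha> ^ n\<close>. At the root it suffices that the constant is at least 1.\<close>

lemma boundary_density_bound:
  assumes B: "cmod B = \<beta>" "\<beta> > 1" and ab: "\<alpha> * \<beta> = real q"
  shows "cmod (boundary_density B f x) \<le> 2 * \<beta>\<^sup>2 / (\<beta>\<^sup>2 - 1) * \<alpha> ^ gd b x *
     cmod (if x = b then f x else f x - f (par b x) / B)"
proof -
  have \<beta>2: "\<beta>\<^sup>2 > 1" using B(2) by (simp add: one_less_power)
  show ?thesis
  proof (cases "x = b")
    case True
    have "1 \<le> 2 * \<beta>\<^sup>2 / (\<beta>\<^sup>2 - 1)" using \<beta>2 by (simp add: le_divide_eq)
    then have "1 * cmod (f b) \<le> 2 * \<beta>\<^sup>2 / (\<beta>\<^sup>2 - 1) * cmod (f b)" by (intro mult_right_mono) auto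
    then show ?thesis using True by (simp add: boundary_density_def)
  next
    case False
    let ?n = "gd b x" and ?m = "cmod (f x - f (par b x) / B)"
    have den: "\<beta>\<^sup>2 - 1 \<le> cmod (B\<^sup>2 - 1)"
      using norm_triangle_ineq2[of "B\<^sup>2" 1] B(1) by (simp add: norm_power)
    have "0 < cmod (B\<^sup>2 - 1)" using den \<beta>2 by linarith
    then have "B\<^sup>2 \<noteq> 1" by auto
    have "cmod (boundary_density B f x) = scard ?n * (?m * (\<beta>\<^sup>2 / (cmod (B\<^sup>2 - 1) * \<beta> ^ ?n)))"
      using False B by (simp add: boundary_density_def norm_mult norm_divide norm_power)
    also have "\<dots> \<le> (2 * real q ^ ?n) * (?m * (\<beta>\<^sup>2 / ((\<beta>\<^sup>2 - 1) * \<beta> ^ ?n)))"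
      using den \<beta>2 B(2) \<open>0 < cmod (B\<^sup>2 - 1)\<close> by (intro mult_mono card_sphere_le mult_left_mono divide_left_mono mult_right_mono mult_pos_pos) auto
    also have "\<dots> = 2 * \<beta>\<^sup>2 / (\<beta>\<^sup>2 - 1) * \<alpha> ^ ?n * ?m"
    proof -
      have "(2 * (u * v)) * (m * (s / (d * v))) = 2 * s / d * u * m" if "v > 0" "d > 0" for u v m s d :: real
        using that by (simp add: field_simps)
      then show ?thesis unfolding ab[symmetric] power_mult_distrib using \<beta>2 B(2) by simp
    qed
    finally show ?thesis using False by simp
  qed
qed

lemma poisson_representation:
  assumes r: "r > 2" and f: "weak_type r K f" and K: "K \<ge> 0"
    and B: "cmod B = real q powr (1 - 1 / r)"
    and eig: "\<And>x. of_nat (q + 1) * avg f x = (B + of_nat q / B) * f x"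
  obtains F where "in_Lp \<nu> r F" "\<And>x. f x = (\<integral>\<omega>. kernel_power b B x \<omega> * F \<omega> \<partial>\<nu>)"
proof -
  define \<alpha> \<beta> where "\<alpha> = real q powr (1 / r)" and "\<beta> = real q powr (1 - 1 / r)"
  have q1: "real q > 1" using q by simp
  have \<alpha>: "\<alpha> > 0" and \<beta>: "\<beta> > 1" using q1 r by (auto simp: \<alpha>_def \<beta>_def)
  have ab: "\<alpha> * \<beta> = real q" using q1 by (simp add: \<alpha>_def \<beta>_def powr_add[symmetric])
  have Bb: "cmod B = \<beta>" "cmod B > 1" "cmod B \<ge> 1" using B \<beta> by (auto simp: \<beta>_def)
  have \<alpha>r: "(\<alpha> ^ n) powr r = real q ^ n" for n
    using q1 r by (simp add: \<alpha>_def powr_realpow[symmetric] powr_powr)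
  define m where "m x = (if x = b then f x else f x - f (par b x) / B)" for x
  define K2 where "K2 = K * (real q + 2) * 2 powr r"
  have K2: "K2 \<ge> 0" using K by (simp add: K2_def)
  have wm: "weak_type r K2 m"
    unfolding K2_def m_def by (rule weak_type_radial_derivative[OF f K Bb(3)])
  let ?\<Phi> = "boundary_density B f"
  define C0 where "C0 = 2 * \<beta>\<^sup>2 / (\<beta>\<^sup>2 - 1)"
  have C0: "C0 > 0" using \<beta> by (simp add: C0_def one_less_power)
  have \<Phi>: "cmod (?\<Phi> x) \<le> C0 * \<alpha> ^ gd b x * cmod (m x)" for x
    unfolding C0_def m_def by (rule boundary_density_bound[OF Bb(1) \<beta> ab])
  have mart: "martingale ?\<Phi>" by (rule martingale_boundary_density[OF eig Bb(2)])
  define C where "C = 1 + 4 * K2 / (1 - 2 powr (2 - r))"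
  have C: "C \<ge> 0"
  proof -
    have "(2::real) powr (2 - r) < 1" using r by (simp add: powr_less_one)
    then show ?thesis using K2 by (simp add: C_def)
  qed
  \<comment> \<open>The exponents balance: the weight \<open>(\<alpha> ^ n)\<^sup>2\<close> equals
    \<open>(q ^ n) powr (2 / r)\<close> and is compensated by the factor
    \<open>scard n powr (- 2 / r)\<close> that remains from \<open>weak_type_sum_squares\<close>
    after averaging over the sphere.\<close>
  have energy: "ray_energy ?\<Phi> n \<le> C0\<^sup>2 * C" for n
  proof -
    have "(\<Sum>x\<in>sphere b n. (cmod (?\<Phi> x))\<^sup>2) \<le> (\<Sum>x\<in>sphere b n. (C0 * \<alpha> ^ n)\<^sup>2 * (cmod (m x))\<^sup>2)"
    proof (intro sum_mono)
      fix x assume "x \<in> sphere b n"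
      then have "cmod (?\<Phi> x) \<le> C0 * \<alpha> ^ n * cmod (m x)" using \<Phi>[of x] by (simp add: sphere_def)
      then have "(cmod (?\<Phi> x))\<^sup>2 \<le> (C0 * \<alpha> ^ n * cmod (m x))\<^sup>2" by (intro power_mono) auto
      then show "(cmod (?\<Phi> x))\<^sup>2 \<le> (C0 * \<alpha> ^ n)\<^sup>2 * (cmod (m x))\<^sup>2" by (simp only: power_mult_distrib)
    qed
    also have "\<dots> = (C0 * \<alpha> ^ n)\<^sup>2 * (\<Sum>x\<in>sphere b n. (cmod (m x))\<^sup>2)" by (simp only: sum_distrib_left)
    also have "\<dots> \<le> (C0 * \<alpha> ^ n)\<^sup>2 * (C * scard n powr (1 - 2 / r))"
      unfolding C_def using weak_type_card_le[OF wm] K2 r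
      by (intro mult_left_mono weak_type_sum_squares) auto
    also have "\<dots> = scard n * (C0\<^sup>2 * C * ((\<alpha> ^ n)\<^sup>2 * scard n powr (- 2 / r)))"
    proof -
      have "scard n powr (1 - 2 / r) = scard n powr 1 * scard n powr (- 2 / r)"
        unfolding powr_add[symmetric] by simp
      then show ?thesis using scard_pos[of n] by (simp add: power_mult_distrib mult_ac)
    qed
    also have "\<dots> \<le> scard n * (C0\<^sup>2 * C * 1)"
    proof (intro mult_left_mono)
      have "scard n powr (- 2 / r) \<le> (real q ^ n) powr (- 2 / r)"
        using card_sphere_ge[of n b] q1 r by (intro powr_mono2') auto
      also have "\<dots> = 1 / (\<alpha> ^ n)\<^sup>2"
      proof -
        have "(real q ^ n) powr (- 2 / r) = (\<alpha> ^ n) powr (- 2)"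
          unfolding \<alpha>r[symmetric] using r by (simp add: powr_powr)
        also have "\<dots> = 1 / (\<alpha> ^ n)\<^sup>2" using \<alpha> by (simp add: powr_minus_divide)
        finally show ?thesis .
      qed
      finally show "(\<alpha> ^ n)\<^sup>2 * scard n powr (- 2 / r) \<le> 1" using \<alpha> by (simp add: field_simps)
    qed (use C in auto)
    finally have "(\<Sum>x\<in>sphere b n. (cmod (?\<Phi> x))\<^sup>2) \<le> scard n * (C0\<^sup>2 * C)" by simp
    then show ?thesis
      unfolding ray_energy_def integral_ray[of "\<lambda>x. (cmod (?\<Phi> x))\<^sup>2"]
      using scard_pos[of n] by (simp add: field_simps)
  qed
  obtain F where F: "integrable \<nu> F" and lim: "(\<lambda>n. \<integral>\<omega>. cmod (F \<omega> - ?\<Phi> (\<omega> n)) \<partial>\<nu>) \<longlonglongrightarrow> 0"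
    using L2_bounded_martingale_limit[OF mart energy] by blast
  \<comment> \<open>Here a weak type bound turns into strong integrability. At radius
    \<open>N + j\<close>, a value of the density above \<open>\<alpha> ^ j\<close> forces the
    modulus of \<open>m\<close> above \<open>1 / (C0 * \<alpha> ^ N)\<close>, a threshold
    independent of \<open>j\<close>. All layers therefore count points of the single set
    \<open>?A\<close> on disjoint spheres. The bound for its size grows like \<open>q ^ N\<close>,
    and the normalisation cancels exactly this power.\<close>
  have layers: "(\<Sum>j<J. real q ^ j * prob {\<omega>\<in>space \<nu>. cmod (?\<Phi> (\<omega> (N + j))) > \<alpha> ^ j}) \<le> K2 * C0 powr r" for J N
  proof -
    let ?t = "1 / (C0 * \<alpha> ^ N)"
    let ?A = "{x. cmod (m x) > ?t}"
    have t: "?t > 0" using C0 \<alpha> by simp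
    have A: "finite ?A" "real (card ?A) \<le> K2 * ?t powr (- r)"
      using wm t unfolding weak_type_def by blast+
    have one: "real q ^ j * prob {\<omega>\<in>space \<nu>. cmod (?\<Phi> (\<omega> (N + j))) > \<alpha> ^ j} \<le>
        real (card (?A \<inter> sphere b (N + j))) / real q ^ N" for j
    proof -
      have sub: "{x\<in>sphere b (N + j). cmod (?\<Phi> x) > \<alpha> ^ j} \<subseteq> ?A \<inter> sphere b (N + j)"
      proof
        fix x assume x: "x \<in> {x\<in>sphere b (N + j). cmod (?\<Phi> x) > \<alpha> ^ j}"
        then have "\<alpha> ^ j < C0 * \<alpha> ^ (N + j) * cmod (m x)"
          using \<Phi>[of x] by (auto simp: sphere_def)
        then have "\<alpha> ^ j * 1 < \<alpha> ^ j * (C0 * \<alpha> ^ N * cmod (m x))" by (simp add: power_add mult_ac)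
        then have "1 < C0 * \<alpha> ^ N * cmod (m x)" using \<alpha> by (simp only: mult_less_cancel_left_pos zero_less_power)
        then have "?t < cmod (m x)" using C0 \<alpha> by (simp add: divide_less_eq mult_ac)
        then show "x \<in> ?A \<inter> sphere b (N + j)" using x by blast
      qed
      have "prob {\<omega>\<in>space \<nu>. cmod (?\<Phi> (\<omega> (N + j))) > \<alpha> ^ j} =
          real (card {x\<in>sphere b (N + j). cmod (?\<Phi> x) > \<alpha> ^ j}) / scard (N + j)"
        by (rule prob_ray)
      also have "\<dots> \<le> real (card (?A \<inter> sphere b (N + j))) / real q ^ (N + j)"
        using card_mono[OF _ sub] card_sphere_ge[of "N + j" b] q1 by (intro frac_le) auto
      finally have "real q ^ j * prob {\<omega>\<in>space \<nu>. cmod (?\<Phi> (\<omega> (N + j))) > \<alpha> ^ j} \<le>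
          real q ^ j * (real (card (?A \<inter> sphere b (N + j))) / real q ^ (N + j))"
        using q1 by (intro mult_left_mono) auto
      also have "\<dots> = real (card (?A \<inter> sphere b (N + j))) / real q ^ N"
        using q1 by (simp add: power_add)
      finally show ?thesis .
    qed
    have "(\<Sum>j<J. real q ^ j * prob {\<omega>\<in>space \<nu>. cmod (?\<Phi> (\<omega> (N + j))) > \<alpha> ^ j}) \<le>
        (\<Sum>j<J. real (card (?A \<inter> sphere b (N + j))) / real q ^ N)"
      by (intro sum_mono one)
    also have "\<dots> = real (\<Sum>j<J. card (?A \<inter> sphere b (N + j))) / real q ^ N"
      by (simp only: sum_divide_distrib[symmetric] of_nat_sum)
    also have "(\<Sum>j<J. card (?A \<inter> sphere b (N + j))) = card (\<Union>j<J. ?A \<inter> sphere b (N + j))"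
      by (rule card_UN_disjoint[symmetric]) (simp, simp, fastforce simp: sphere_def)
    also have "real (card (\<Union>j<J. ?A \<inter> sphere b (N + j))) / real q ^ N \<le> real (card ?A) / real q ^ N"
      using A(1) by (intro divide_right_mono of_nat_mono card_mono) auto
    also have "\<dots> \<le> K2 * ?t powr (- r) / real q ^ N"
      using A(2) by (intro divide_right_mono) auto
    also have "?t powr (- r) = C0 powr r * real q ^ N"
    proof -
      have "?t powr (- r) = (C0 * \<alpha> ^ N) powr r"
        using C0 \<alpha> by (simp add: powr_divide powr_minus_divide)
      then show ?thesis using C0 \<alpha> by (simp add: powr_mult \<alpha>r)
    qed
    finally show ?thesis using q1 by simp
  qed
  have "in_Lp \<nu> r F"
  proof (rule in_Lp_if_layers_bounded)
    show "(\<Sum>j<J. real q ^ j * prob {\<omega>\<in>space \<nu>. cmod (F \<omega>) > 2 * (real q powr (1 / r)) ^ j}) \<le> K2 * C0 powr r" for J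
      using prob_limit_le[OF F lim \<alpha>, of "\<lambda>j. real q ^ j" J, OF _ layers] by (simp add: \<alpha>_def)
  qed (use F r in auto)
  \<comment> \<open>Integrability is part of the induction because the kernel step splits the
    integral into a sum.\<close>
  moreover have "integrable \<nu> (\<lambda>\<omega>. kernel_power b B x \<omega> * F \<omega>) \<and>
      f x = (\<integral>\<omega>. kernel_power b B x \<omega> * F \<omega> \<partial>\<nu>)" for x
  proof (induction "gd b x" arbitrary: x)
    case 0
    then have x: "x = b" by (metis gd_eq_0)
    have ker: "kernel_power b B b \<omega> * F \<omega> = F \<omega>" if "\<omega> \<in> space \<nu>" for \<omega>
      using that by (simp add: space_nu kernel_power_root)
    have "(\<integral>\<omega>. kernel_power b B b \<omega> * F \<omega> \<partial>\<nu>) = (\<integral>\<omega>. F \<omega> \<partial>\<nu>)"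
      by (rule Bochner_Integration.integral_cong[OF refl ker])
    also have "\<dots> = (\<integral>\<omega>. indicator (cylinder E b b) \<omega> * F \<omega> \<partial>\<nu>)"
      by (rule Bochner_Integration.integral_cong) (auto simp: space_nu cylinder_root)
    also have "\<dots> = f b"
      unfolding integral_cylinder_limit[OF mart F lim] by (simp add: boundary_density_def)
    moreover have "integrable \<nu> (\<lambda>\<omega>. kernel_power b B b \<omega> * F \<omega>)"
      by (subst Bochner_Integration.integrable_cong[OF refl ker]) (assumption, rule F)
    ultimately show ?case unfolding x by simp
  next
    case (Suc n)
    then have x: "x \<noteq> b" by auto
    let ?y = "par b x" and ?c = "(B\<^sup>2 - 1) * B ^ gd b x / B\<^sup>2"
    have B0: "B \<noteq> 0" "B\<^sup>2 - 1 \<noteq> 0"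
    proof -
      show "B \<noteq> 0" using Bb by auto
      have "cmod (B\<^sup>2) > 1" using Bb(2) by (simp add: norm_power one_less_power)
      then show "B\<^sup>2 - 1 \<noteq> 0" by auto
    qed
    have "gd b ?y = n" using Suc par(2)[OF x] by simp
    then have IH: "integrable \<nu> (\<lambda>\<omega>. kernel_power b B ?y \<omega> * F \<omega>)"
      "(\<integral>\<omega>. kernel_power b B ?y \<omega> * F \<omega> \<partial>\<nu>) = f ?y" using Suc(1)[of ?y] by auto
    have ker: "kernel_power b B x \<omega> * F \<omega> =
        kernel_power b B ?y \<omega> * F \<omega> / B + ?c * (indicator (cylinder E b x) \<omega> * F \<omega>)" if "\<omega> \<in> space \<nu>" for \<omega>
      using kernel_power_step[of \<omega> b x B] that x B0 by (simp add: space_nu algebra_simps)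
    have int: "integrable \<nu> (\<lambda>\<omega>. kernel_power b B ?y \<omega> * F \<omega> / B)"
        "integrable \<nu> (\<lambda>\<omega>. ?c * (indicator (cylinder E b x) \<omega> * F \<omega>))"
      by (rule integrable_divide[OF IH(1)], rule integrable_mult_right[OF integrable_cylinder_mult[OF F]])
    have "(\<integral>\<omega>. kernel_power b B x \<omega> * F \<omega> \<partial>\<nu>) =
      (\<integral>\<omega>. kernel_power b B ?y \<omega> * F \<omega> / B + ?c * (indicator (cylinder E b x) \<omega> * F \<omega>) \<partial>\<nu>)"
      by (rule Bochner_Integration.integral_cong[OF refl ker])
    also have "\<dots> = f ?y / B + ?c * (?\<Phi> x / of_real (scard (gd b x)))"
      unfolding Bochner_Integration.integral_add[OF int] integral_divide_zero integral_mult_right_zero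
        IH(2) integral_cylinder_limit[OF mart F lim] ..
    also have "?c * (?\<Phi> x / of_real (scard (gd b x))) = f x - f ?y / B"
    proof -
      have "complex_of_real (scard (gd b x)) \<noteq> 0" unfolding of_real_eq_0_iff using scard_pos[of "gd b x"] by linarith
      moreover have "(B\<^sup>2 - 1) * B ^ n / B\<^sup>2 * (k * (y * B\<^sup>2 / ((B\<^sup>2 - 1) * B ^ n)) / k) = y" if "k \<noteq> 0" for k y n
        using B0 that by simp
      ultimately show ?thesis unfolding boundary_density_def if_not_P[OF x] by blast
    qed
    finally have "(\<integral>\<omega>. kernel_power b B x \<omega> * F \<omega> \<partial>\<nu>) = f x" by simp
    moreover have "integrable \<nu> (\<lambda>\<omega>. kernel_power b B x \<omega> * F \<omega>)"
      by (subst Bochner_Integration.integrable_cong[OF refl ker])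
        (assumption, rule Bochner_Integration.integrable_add[OF int])
    ultimately show ?case by simp
  qed
  ultimately show ?thesis using that by blast
qed

text \<open>The parameter \<open>z\<close> is translated into
  \<open>B = q powr (1/2 + \<i> * z)\<close>. The companion power is \<open>q / B\<close>, so the
  eigenvalue equation takes the form with \<open>B + q / B\<close>, and the hypothesis on the real
  part fixes the modulus of \<open>B\<close>.\<close>

lemma poisson_transform_representation:
  assumes r: "r > 2" and f: "weak_type r K f" and K: "K \<ge> 0"
    and z: "Re (1 / 2 + \<i> * z) = 1 - 1 / r"
    and eig: "lap E q f = (\<lambda>x. gam q z * f x)"
  shows "\<exists>F. in_Lp \<nu> r F \<and> f = poisson_transform E q \<nu> z F"
proof -
  define B where "B = of_real (real q) powr (1 / 2 + \<i> * z)"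
  have q0: "of_real (real q) \<noteq> (0::complex)" using q by simp
  have "cmod (of_real (real q) powr s) = real q powr Re s" for s
    using q by (simp add: powr_def Ln_of_real)
  then have "cmod B = real q powr (1 - 1 / r)"
    unfolding B_def z[symmetric] .
  moreover have "of_nat (q + 1) * avg f x = (B + of_nat q / B) * f x" for x
  proof -
    have 1: "of_real (real q) powr (1 / 2 - \<i> * z) = of_nat q / B"
    proof -
      have "of_real (real q) powr (1 / 2 - \<i> * z) = of_real (real q) powr (1 - (1 / 2 + \<i> * z))" by simp
      also have "\<dots> = of_nat q / B" unfolding powr_diff B_def using q0 by simp
      finally show ?thesis .
    qed
    have q1: "(of_nat (q + 1) :: complex) \<noteq> 0" unfolding of_nat_eq_0_iff by simp
    have g: "gam q z = 1 - (B + of_nat q / B) / of_nat (q + 1)" unfolding gam_def 1 B_def ..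
    have "f x - avg f x = gam q z * f x" using fun_cong[OF eig, of x] by (simp add: lap_avg)
    then have avg: "avg f x = (B + of_nat q / B) / of_nat (q + 1) * f x" unfolding g by (simp only: algebra_simps) simp
    have "k * (w / k * y) = w * y" if "k \<noteq> 0" for k w y :: complex using that by simp
    from this[OF q1] show ?thesis unfolding avg .
  qed
  ultimately obtain F where F: "in_Lp \<nu> r F" "\<And>x. f x = (\<integral>\<omega>. kernel_power b B x \<omega> * F \<omega> \<partial>\<nu>)"
    using poisson_representation[OF r f K] by blast
  have "f = poisson_transform E q \<nu> z F"
  proof
    fix x
    have "poisson_transform E q \<nu> z F x = (\<integral>\<omega>. kernel_power b B x \<omega> * F \<omega> \<partial>\<nu>)"
      unfolding poisson_transform_def B_def
      by (rule Bochner_Integration.integral_cong) (simp_all add: poisson_kernel_powr space_nu)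
    then show "f x = poisson_transform E q \<nu> z F x" using F(2) by simp
  qed
  then show ?thesis using F(1) by blast
qed

end

section \<open>Values of gamma and the two cases of the theorem\<close>

lemma lap_divide: "lap E q (\<lambda>x. h x / c) x = lap E q h x / c"
  by (simp add: lap_def sum_divide_distrib[symmetric] diff_divide_distrib)

text \<open>By the choice of \<open>tau\<close>, adding \<open>\<i> * tau q / 2\<close> to the
  exponent multiplies the power by \<open>exp (\<i> * pi) = -1\<close>.\<close>

lemma powr_period:
  assumes q: "q \<ge> 2"
  shows "of_real (real q) powr (of_real s + \<i> * of_real (of_int k * tau q / 2)) =
    (- 1) powi k * of_real (real q powr s)"
proof -
  have l: "ln (real q) \<noteq> 0" using q by simp
  have "of_real (real q) powr (of_real s + \<i> * of_real (of_int k * tau q / 2)) =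
    of_real (real q) powr of_real s * of_real (real q) powr (\<i> * of_real (of_int k * tau q / 2))"
    by (rule powr_add)
  also have "of_real (real q) powr of_real s = (of_real (real q powr s) :: complex)"
    using q by (subst powr_of_real) auto
  also have "of_real (real q) powr (\<i> * of_real (of_int k * tau q / 2)) = exp (\<i> * of_real (of_int k * pi))"
  proof -
    have "of_int k * tau q / 2 * ln (real q) = of_int k * pi" using l by (simp add: tau_def)
    then have "\<i> * of_real (of_int k * tau q / 2) * of_real (ln (real q)) = \<i> * of_real (of_int k * pi)"
      by (simp only: mult.assoc of_real_mult[symmetric])
    moreover have "of_real (real q) powr s = exp (s * of_real (ln (real q)))" for s :: complex
      using q by (simp add: powr_def Ln_of_real)
    ultimately show ?thesis by (simp only:)
  qed
  also have "\<dots> = exp (of_int k * (\<i> * of_real pi))" by (simp add: mult_ac)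
  also have "\<dots> = exp (\<i> * of_real pi) powi k" by (rule exp_power_int[symmetric])
  finally show ?thesis by (simp add: mult_ac)
qed

theorem theoremB:
  fixes E :: "'v \<Rightarrow> 'v \<Rightarrow> bool" and q :: nat and b :: 'v
    and \<nu> :: "(nat \<Rightarrow> 'v) measure"
    and f :: "'v \<Rightarrow> complex" and p p' :: real
  assumes tree: "homogeneous_tree E q" and q: "q \<ge> 2"
    and nu: "canonical_boundary_measure E q b \<nu>"
    and p: "1 < p" "p < 2" and p': "p' = p / (p - 1)"
  shows
    "(\<forall>z (n::int) M. z = of_real (real_of_int n * tau q) + \<i> * of_real (delta p') \<and> M > 0 \<and>
        (\<forall>k::nat. weak_Lp_norm p' ((lap E q ^^ k) f) \<le> ereal (M * cmod (gam q z) ^ k))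
      \<longrightarrow> lap E q f = (\<lambda>x. gam q z * f x) \<and>
          (\<exists>F. in_Lp \<nu> p' F \<and> f = poisson_transform E q \<nu> z F))
   \<and>
    (\<forall>z (n::int) M g. z = of_real ((2 * real_of_int n + 1) * tau q / 2) + \<i> * of_real (delta p') \<and>
        g 0 = f \<and> (\<forall>k. lap E q (g (Suc k)) = g k) \<and> M > 0 \<and>
        (\<forall>k::nat. weak_Lp_norm p' (g k) \<le> ereal (M / cmod (gam q z) ^ k))
      \<longrightarrow> lap E q f = (\<lambda>x. gam q z * f x) \<and>
          (\<exists>F. in_Lp \<nu> p' F \<and> f = poisson_transform E q \<nu> z F))"
proof -
  interpret htree_boundary E q b \<nu> by standard (rule tree q nu)+
  have r: "p' > 2" using p unfolding p' by (simp add: less_divide_eq)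
  define \<alpha> \<beta> \<rho> where "\<alpha> = real q powr (1 / p')" and "\<beta> = real q powr (1 - 1 / p')"
    and "\<rho> = (\<alpha> + \<beta>) / (real q + 1)"
  have q1: "real q > 1" using q by simp
  have ab: "\<alpha> * \<beta> = real q" "\<alpha> > 1" "\<beta> > 1"
    using q1 r by (auto simp: \<alpha>_def \<beta>_def powr_add[symmetric])
  have "(\<alpha> - 1) * (\<beta> - 1) > 0" using ab by simp
  then have \<rho>: "0 < \<rho>" "\<rho> < 1" using ab q1 by (auto simp: \<rho>_def algebra_simps)
  \<comment> \<open>Both cases use the form \<open>k * tau q / 2\<close> for the real part of
    \<open>z\<close>, with \<open>k\<close> even in the first and odd in the second. The exponents
    become \<open>1 / 2 - delta p' = 1 - 1 / p'\<close> and
    \<open>1 / 2 + delta p' = 1 / p'\<close>.\<close>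
  have z_half: "1 / 2 + \<i> * z = of_real (1 - 1 / p') + \<i> * of_real (of_int k * tau q / 2)"
      "1 / 2 - \<i> * z = of_real (1 / p') + \<i> * of_real (of_int (- k) * tau q / 2)"
    if "z = of_real (of_int k * tau q / 2) + \<i> * of_real (delta p')" for z k
    unfolding that delta_def by (auto simp: complex_eq_iff)
  \<comment> \<open>The shifts by \<open>k\<close> and by \<open>- k\<close> produce the same sign,
    so gamma is real: \<open>1 - \<rho>\<close> for even \<open>k\<close> and
    \<open>1 + \<rho>\<close> for odd \<open>k\<close>.\<close>
  have gam: "gam q z = 1 - (- 1) powi k * of_real \<rho>"
    if "z = of_real (of_int k * tau q / 2) + \<i> * of_real (delta p')" for z k
  proof -
    have "(- 1 :: complex) powi (- k) = (- 1) powi k" by (simp add: power_int_minus flip: power_int_inverse)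
    then show ?thesis
      unfolding gam_def z_half[OF that] powr_period[OF q] \<rho>_def \<alpha>_def \<beta>_def
      by (simp add: field_simps)
  qed
  \<comment> \<open>This is the constant of \<open>ssum_bounded_if_weak_type\<close> for the weak
    type constant \<open>M powr p'\<close>. It does not involve the normalising factor
    \<open>c\<close> below, so one bound serves the whole normalised orbit.\<close>
  define K where "K M = 4 * sqrt (1 + 4 * M powr p' / (1 - 2 powr (2 - p')))" for M
  have K0: "K M \<ge> 0" if "M > 0" for M
  proof -
    have "(2::real) powr (2 - p') < 1" using r by (simp add: powr_less_one)
    then show ?thesis using that by (simp add: K_def)
  qed
  have bounded: "ssum_bounded \<beta> (K M) (\<lambda>x. h x / c)"
    if "weak_Lp_norm p' h \<le> ereal (M * cmod c)" "M > 0" "c \<noteq> 0" for h M c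
  proof -
    have "weak_type p' ((M * cmod c) powr p') h"
      using that r by (intro weak_type_if_weak_Lp_norm_le) auto
    from weak_type_divide[OF this that(3)]
    moreover have "(M * cmod c) powr p' * cmod c powr (- p') = M powr p'"
      using that by (simp add: powr_mult powr_minus_divide)
    ultimately have "weak_type p' (M powr p') (\<lambda>x. h x / c)" by (simp only:)
    then show ?thesis unfolding K_def \<beta>_def using r by (intro ssum_bounded_if_weak_type) auto
  qed
  have weak: "weak_type p' (M powr p') h" if "weak_Lp_norm p' h \<le> ereal M" "M > 0" for h M
    using that r by (intro weak_type_if_weak_Lp_norm_le) auto
  have representation: "\<exists>F. in_Lp \<nu> p' F \<and> f = poisson_transform E q \<nu> z F"
    if "z = of_real (of_int k * tau q / 2) + \<i> * of_real (delta p')"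
      "weak_Lp_norm p' f \<le> ereal M" "M > 0" "lap E q f = (\<lambda>x. gam q z * f x)" for z k M
    using that(4) by (intro poisson_transform_representation[OF r weak[OF that(2,3)]])
      (auto simp: z_half(1)[OF that(1)])
  show ?thesis
  proof (intro conjI allI impI; elim conjE)
    fix z M and n :: int
    assume z: "z = of_real (real_of_int n * tau q) + \<i> * of_real (delta p')" and M: "M > 0"
      and bd: "\<forall>k::nat. weak_Lp_norm p' ((lap E q ^^ k) f) \<le> ereal (M * cmod (gam q z) ^ k)"
    have z': "z = of_real (of_int (2 * n) * tau q / 2) + \<i> * of_real (delta p')" unfolding z by simp
    have g: "gam q z = 1 - of_real \<rho>" using gam[OF z'] by (simp add: power_int_mult)
    then have g0: "gam q z \<noteq> 0" using \<rho> by (metis eq_iff_diff_eq_0 less_irrefl of_real_1 of_real_eq_iff)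
    let ?g = "\<lambda>m x. (lap E q ^^ m) f x / gam q z ^ m"
    have orbit: "lap E q (?g m) = (\<lambda>x. (1 - of_real \<rho>) * ?g (Suc m) x)" for m
      using g0 unfolding g[symmetric]
      by (simp add: fun_eq_iff lap_divide)
    have "avg (?g 0) x = of_real \<rho> * ?g 0 x" for x
    proof (rule eigenfunction_if_forward_orbit[where g = ?g, OF ab \<rho>_def _ K0[OF M] orbit])
      show "ssum_bounded \<beta> (K M) (?g m)" for m
        using bd g0 M by (intro bounded) (auto simp: norm_power)
    qed
    then show eig: "lap E q f = (\<lambda>x. gam q z * f x)" by (auto simp: lap_avg g algebra_simps)
    show "\<exists>F. in_Lp \<nu> p' F \<and> f = poisson_transform E q \<nu> z F"
      using bd[rule_format, of 0] by (intro representation[OF z' _ M eig]) simp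
  next
    fix z M g and n :: int
    assume z: "z = of_real ((2 * real_of_int n + 1) * tau q / 2) + \<i> * of_real (delta p')" and M: "M > 0"
      and g0: "g 0 = f" and lap: "\<forall>k. lap E q (g (Suc k)) = g k"
      and bd: "\<forall>k::nat. weak_Lp_norm p' (g k) \<le> ereal (M / cmod (gam q z) ^ k)"
    have z': "z = of_real (of_int (2 * n + 1) * tau q / 2) + \<i> * of_real (delta p')" unfolding z by simp
    have "(- 1 :: complex) powi (2 * n + 1) = - 1" by (simp add: power_int_add power_int_mult)
    then have g: "gam q z = 1 + of_real \<rho>" using gam[OF z'] by simp
    then have g1: "gam q z \<noteq> 0" using \<rho>
      by (metis add_pos_pos less_irrefl less_numeral_extra(1) of_real_0 of_real_1 of_real_add of_real_eq_iff)
    \<comment> \<open>Multiplication by powers of gamma is written as division by powers of its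
      inverse, so that \<open>bounded\<close> applies with \<open>c\<close> equal to the
      \<open>m\<close>-th power of the inverse.\<close>
    let ?g = "\<lambda>m x. g m x / inverse (gam q z) ^ m"
    have orbit: "lap E q (?g (Suc m)) = (\<lambda>x. (1 + of_real \<rho>) * ?g m x)" for m
    proof
      fix x
      have "lap E q (?g (Suc m)) x = lap E q (g (Suc m)) x / inverse (gam q z) ^ Suc m"
        by (rule lap_divide)
      then show "lap E q (?g (Suc m)) x = (1 + of_real \<rho>) * ?g m x"
        using g1 lap unfolding g[symmetric] by (simp add: field_simps)
    qed
    have bounded': "ssum_bounded \<beta> (K M) (?g m)" for m
      using bd g1 M by (intro bounded) (auto simp: norm_power norm_inverse divide_inverse power_inverse)
    note eigen = eigenfunction_if_backward_orbit[where g = ?g, OF ab \<rho>_def bounded' K0[OF M] orbit]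
    \<comment> \<open>The eigenvalue equation is available at index 1 and is moved here to index 0,
      where the function is \<open>f\<close>.\<close>
    have "?g 0 = ?g 1" using eigen(2) by blast
    then have "avg (?g 0) x = - of_real \<rho> * ?g 0 x" for x using eigen(1) by simp
    then show eig: "lap E q f = (\<lambda>x. gam q z * f x)" by (auto simp: lap_avg g g0 algebra_simps)
    show "\<exists>F. in_Lp \<nu> p' F \<and> f = poisson_transform E q \<nu> z F"
      using bd[rule_format, of 0] by (intro representation[OF z' _ M eig]) (simp add: g0)
  qed
qed

end
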